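(* Let $l\ge 2$ and $d_1,\ldots,d_l\ge 2$ be integers. $O_{\otimes}(\otimes_{i=1}^l\mathbb{R}^{d_i})$ is a maximal compact subgroup of $GL_{\otimes}(\otimes_{i=1}^l\mathbb{R}^{d_i})$.
   Context: $\otimes_{i=1}^l\mathbb{R}^{d_i}$ is a Euclidean space with the scalar product $\langle\cdot,\cdot\rangle_H$ determined by $\langle x^1\otimes\cdots\otimes x^l,y^1\otimes\cdots\otimes y^l\rangle_H=\prod_{i=1}^l\langle x^i,y^i\rangle$. A decomposable vector is one of the form $x^1\otimes\cdots\otimes x^l$, $x^i\in\mathbb{R}^{d_i}$. $GL_\otimes(\otimes_{i=1}^l\mathbb{R}^{d_i})$ is the group of linear isomorphisms of $\otimes_{i=1}^l\mathbb{R}^{d_i}$ mapping decomposable vectors to decomposable vectors; it is a closed subgroup of $GL(\otimes_{i=1}^l\mathbb{R}^{d_i})$ (with the operator norm topology), hence a Lie group. $O_\otimes(\otimes_{i=1}^l\mathbb{R}^{d_i})$ is the subgroup of its elements that are orthogonal for $\langle\cdot,\cdot\rangle_H$. *)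

theory Defs
  imports "HOL-Analysis.Analysis" "HOL-Algebra.Bij"
begin

section \<open>The Euclidean spaces \<open>\<real>\<^sup>I\<close> and their linear groups\<close>

text \<open>
  For a finite set \<open>I\<close> of indices, \<open>\<real>\<^sup>I\<close> consists of the families of reals extended by 0 outside
  \<open>I\<close>; in particular \<open>euclid {..<n}\<close> is \<open>\<real>\<^sup>n\<close>, and its norm is \<^term>\<open>\<lambda>v. L2_set v I\<close>.
\<close>

definition euclid :: "'i set \<Rightarrow> ('i \<Rightarrow> real) set"
  where "euclid I = {v. \<forall>a. a \<notin> I \<longrightarrow> v a = 0}"

definition ip :: "'i set \<Rightarrow> ('i \<Rightarrow> real) \<Rightarrow> ('i \<Rightarrow> real) \<Rightarrow> real"
  where "ip I u v = (\<Sum>a\<in>I. u a * v a)"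

definition linear_on_euclid :: "'i set \<Rightarrow> (('i \<Rightarrow> real) \<Rightarrow> ('i \<Rightarrow> real)) \<Rightarrow> bool"
  where "linear_on_euclid I f \<longleftrightarrow>
    (\<forall>u\<in>euclid I. \<forall>v\<in>euclid I. f (\<lambda>a. u a + v a) = (\<lambda>a. f u a + f v a)) \<and>
    (\<forall>c. \<forall>v\<in>euclid I. f (\<lambda>a. c * v a) = (\<lambda>a. c * f v a))"

definition GL :: "'i set \<Rightarrow> (('i \<Rightarrow> real) \<Rightarrow> ('i \<Rightarrow> real)) monoid"
  where "GL I = (BijGroup (euclid I))
    \<lparr>carrier := {f \<in> carrier (BijGroup (euclid I)). linear_on_euclid I f}\<rparr>"

definition op_norm :: "'i set \<Rightarrow> (('i \<Rightarrow> real) \<Rightarrow> ('i \<Rightarrow> real)) \<Rightarrow> real"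
  where "op_norm I h = (SUP v\<in>euclid I. L2_set (h v) I / L2_set v I)"

text \<open>
  The value 0 away from the group is a dummy: \<^term>\<open>Metric_space\<close> requires nonnegative distances
  on the whole type, where the supremum may fail to exist.
\<close>

definition GL_dist ::
    "'i set \<Rightarrow> (('i \<Rightarrow> real) \<Rightarrow> ('i \<Rightarrow> real)) \<Rightarrow> (('i \<Rightarrow> real) \<Rightarrow> ('i \<Rightarrow> real)) \<Rightarrow> real"
  where "GL_dist I f g =
    (if f \<in> carrier (GL I) \<and> g \<in> carrier (GL I) then op_norm I (\<lambda>v a. f v a - g v a) else 0)"

definition GL_topology :: "'i set \<Rightarrow> (('i \<Rightarrow> real) \<Rightarrow> ('i \<Rightarrow> real)) topology"
  where "GL_topology I = Metric_space.mtopology (carrier (GL I)) (GL_dist I)"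


section \<open>The tensor product of \<open>\<real>\<^bsup>d 0\<^esup>, \<dots>, \<real>\<^bsup>d (l - 1)\<^esup>\<close>\<close>

text \<open>
  The tensor product is modelled by the arrays of coordinates with respect to the tensor products
  of standard basis vectors, indexed by the multi-indices \<open>\<alpha>\<close> with \<open>\<alpha> i < d i\<close> for all \<open>i < l\<close>.
\<close>

definition multi_indices :: "nat \<Rightarrow> (nat \<Rightarrow> nat) \<Rightarrow> (nat \<Rightarrow> nat) set"
  where "multi_indices l d = (\<Pi>\<^sub>E i\<in>{..<l}. {..<d i})"

abbreviation tensor_space :: "nat \<Rightarrow> (nat \<Rightarrow> nat) \<Rightarrow> ((nat \<Rightarrow> nat) \<Rightarrow> real) set"
  where "tensor_space l d \<equiv> euclid (multi_indices l d)"

text \<open>\<open>\<langle>S, T\<rangle>\<^sub>H\<close>; see lemmas \<open>ip_H_tensor\<close> and \<open>ip_H_unique\<close> below.\<close>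

abbreviation ip_H :: "nat \<Rightarrow> (nat \<Rightarrow> nat) \<Rightarrow> ((nat \<Rightarrow> nat) \<Rightarrow> real) \<Rightarrow> ((nat \<Rightarrow> nat) \<Rightarrow> real) \<Rightarrow> real"
  where "ip_H l d \<equiv> ip (multi_indices l d)"

definition tensor :: "nat \<Rightarrow> (nat \<Rightarrow> nat) \<Rightarrow> (nat \<Rightarrow> nat \<Rightarrow> real) \<Rightarrow> (nat \<Rightarrow> nat) \<Rightarrow> real"
  where "tensor l d x = (\<lambda>\<alpha>. if \<alpha> \<in> multi_indices l d then \<Prod>i<l. x i (\<alpha> i) else 0)"

definition decomposables :: "nat \<Rightarrow> (nat \<Rightarrow> nat) \<Rightarrow> ((nat \<Rightarrow> nat) \<Rightarrow> real) set"
  where "decomposables l d = {tensor l d x | x. \<forall>i<l. x i \<in> euclid {..<d i}}"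

text \<open>
  Only \<open>f\<close> itself is required to preserve decomposability, not its inverse: for a linear isomorphism
  the latter is automatic.
\<close>

definition GL_tensor :: "nat \<Rightarrow> (nat \<Rightarrow> nat) \<Rightarrow>
    (((nat \<Rightarrow> nat) \<Rightarrow> real) \<Rightarrow> ((nat \<Rightarrow> nat) \<Rightarrow> real)) monoid"
  where "GL_tensor l d = (GL (multi_indices l d))
    \<lparr>carrier := {f \<in> carrier (GL (multi_indices l d)). f ` decomposables l d \<subseteq> decomposables l d}\<rparr>"

definition GL_tensor_topology :: "nat \<Rightarrow> (nat \<Rightarrow> nat) \<Rightarrow>
    (((nat \<Rightarrow> nat) \<Rightarrow> real) \<Rightarrow> ((nat \<Rightarrow> nat) \<Rightarrow> real)) topology"
  where "GL_tensor_topology l d =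
    subtopology (GL_topology (multi_indices l d)) (carrier (GL_tensor l d))"

definition O_tensor :: "nat \<Rightarrow> (nat \<Rightarrow> nat) \<Rightarrow> (((nat \<Rightarrow> nat) \<Rightarrow> real) \<Rightarrow> ((nat \<Rightarrow> nat) \<Rightarrow> real)) set"
  where "O_tensor l d = {f \<in> carrier (GL_tensor l d).
    \<forall>S\<in>tensor_space l d. \<forall>T\<in>tensor_space l d. ip_H l d (f S) (f T) = ip_H l d S T}"


section \<open>Maximal compact subgroups\<close>

definition compact_subgroup :: "('a, 'b) monoid_scheme \<Rightarrow> 'a topology \<Rightarrow> 'a set \<Rightarrow> bool"
  where "compact_subgroup G X K \<longleftrightarrow> subgroup K G \<and> compactin X K"

definition maximal_compact_subgroup :: "('a, 'b) monoid_scheme \<Rightarrow> 'a topology \<Rightarrow> 'a set \<Rightarrow> bool"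
  where "maximal_compact_subgroup G X K \<longleftrightarrow>
    compact_subgroup G X K \<and> (\<forall>K'. compact_subgroup G X K' \<and> K \<subseteq> K' \<longrightarrow> K' = K)"


section \<open>Adequacy of the model\<close>

lemma finite_multi_indices: "finite (multi_indices l d)"
  by (simp add: multi_indices_def finite_PiE)

lemma carrier_GL: "f \<in> carrier (GL I) \<longleftrightarrow>
    f \<in> extensional (euclid I) \<and> bij_betw f (euclid I) (euclid I) \<and> linear_on_euclid I f"
  by (auto simp: GL_def BijGroup_def Bij_def)

lemma carrier_GL_closed: "f \<in> carrier (GL I) \<Longrightarrow> v \<in> euclid I \<Longrightarrow> f v \<in> euclid I"
  by (auto simp: carrier_GL bij_betw_def)

lemma group_GL: "group (GL I)"
proof -
  interpret B: group "BijGroup (euclid I)" by (rule group_BijGroup)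
  let ?H = "carrier (GL I)"
  have E: "(\<lambda>a. u a + v a) \<in> euclid I" "(\<lambda>a. c * u a) \<in> euclid I"
    if "u \<in> euclid I" "v \<in> euclid I" for u v c
    using that by (auto simp: euclid_def)
  have car: "f \<in> ?H \<longleftrightarrow> f \<in> Bij (euclid I) \<and> linear_on_euclid I f" for f
    by (auto simp: GL_def BijGroup_def)
  have "subgroup ?H (BijGroup (euclid I))"
  proof (rule B.subgroupI)
    show "?H \<subseteq> carrier (BijGroup (euclid I))" by (auto simp: GL_def)
    show "?H \<noteq> {}"
    proof -
      have "restrict (\<lambda>x. x) (euclid I) \<in> ?H"
        using E by (auto simp: car id_Bij linear_on_euclid_def)
      then show ?thesis by auto
    qed
  next
    fix f assume f: "f \<in> ?H"
    let ?g = "restrict (inv_into (euclid I) f) (euclid I)"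
    have fB: "f \<in> Bij (euclid I)" using f by (simp add: car)
    have b: "bij_betw f (euclid I) (euclid I)" using fB by (simp add: Bij_def)
    have gB: "?g \<in> Bij (euclid I)" using restrict_inv_into_Bij[OF fB] .
    have g: "?g v \<in> euclid I" "f (?g v) = v" if "v \<in> euclid I" for v
      using that bij_betw_inv_into_right[OF b that] Bij_inv_into_mem[OF fB that] by auto
    have inj: "x = y" if "f x = f y" "x \<in> euclid I" "y \<in> euclid I" for x y
      using that b by (auto simp: bij_betw_def inj_on_def)
    have "linear_on_euclid I ?g"
      unfolding linear_on_euclid_def
    proof (intro conjI ballI allI)
      fix u v assume uv: "u \<in> euclid I" "v \<in> euclid I"
      have "f (\<lambda>a. ?g u a + ?g v a) = (\<lambda>a. f (?g u) a + f (?g v) a)"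
        using f g(1)[OF uv(1)] g(1)[OF uv(2)] unfolding car linear_on_euclid_def by blast
      also have "\<dots> = (\<lambda>a. u a + v a)" using g(2)[OF uv(1)] g(2)[OF uv(2)] by simp
      also have "\<dots> = f (?g (\<lambda>a. u a + v a))" using g(2)[OF E(1)[OF uv]] by simp
      finally show "?g (\<lambda>a. u a + v a) = (\<lambda>a. ?g u a + ?g v a)"
        using inj E(1)[OF g(1)[OF uv(1)] g(1)[OF uv(2)]] g(1)[OF E(1)[OF uv]] by metis
    next
      fix c v assume v: "v \<in> euclid I"
      have "f (\<lambda>a. c * ?g v a) = (\<lambda>a. c * f (?g v) a)"
        using f g(1)[OF v] unfolding car linear_on_euclid_def by blast
      also have "\<dots> = (\<lambda>a. c * v a)" using g(2)[OF v] by simp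
      also have "\<dots> = f (?g (\<lambda>a. c * v a))" using g(2)[OF E(2)[OF v v]] by simp
      finally show "?g (\<lambda>a. c * v a) = (\<lambda>a. c * ?g v a)"
        using inj E(2)[OF g(1)[OF v] g(1)[OF v]] g(1)[OF E(2)[OF v v]] by metis
    qed
    then show "inv\<^bsub>BijGroup (euclid I)\<^esub> f \<in> ?H"
      using gB by (simp add: inv_BijGroup[OF fB] car)
  next
    fix f g assume fg: "f \<in> ?H" "g \<in> ?H"
    then have B: "f \<in> Bij (euclid I)" "g \<in> Bij (euclid I)" by (auto simp: car)
    have "linear_on_euclid I (compose (euclid I) f g)"
      using fg carrier_GL_closed[OF fg(2)] E
      by (auto simp: car linear_on_euclid_def compose_def)
    then show "f \<otimes>\<^bsub>BijGroup (euclid I)\<^esub> g \<in> ?H"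
      using B by (simp add: BijGroup_def car compose_Bij)
  qed
  from B.subgroup_imp_group[OF this] show ?thesis
    by (simp add: GL_def)
qed

lemma functional_expand:
  fixes \<phi> :: "('i \<Rightarrow> real) \<Rightarrow> real"
  assumes I: "finite I" and v: "v \<in> euclid I"
    and add: "\<And>u v. u \<in> euclid I \<Longrightarrow> v \<in> euclid I \<Longrightarrow> \<phi> (\<lambda>a. u a + v a) = \<phi> u + \<phi> v"
    and scale: "\<And>c v. v \<in> euclid I \<Longrightarrow> \<phi> (\<lambda>a. c * v a) = c * \<phi> v"
  shows "\<phi> v = (\<Sum>a\<in>I. v a * \<phi> (\<lambda>b. if b = a then 1 else 0))"
proof -
  have "\<phi> (\<lambda>b. if b \<in> J then v b else 0) = (\<Sum>a\<in>J. v a * \<phi> (\<lambda>b. if b = a then 1 else 0))"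
    if "finite J" "J \<subseteq> I" for J
    using that
  proof (induction J rule: finite_induct)
    case empty
    have "(\<lambda>b. 0) \<in> euclid I" by (simp add: euclid_def)
    from scale[OF this, of 0] show ?case by simp
  next
    case (insert a J)
    let ?u = "\<lambda>b. if b \<in> J then v b else 0" and ?e = "\<lambda>b. if b = a then 1 else 0 :: real"
    have m: "?u \<in> euclid I" "?e \<in> euclid I" "(\<lambda>b. v a * ?e b) \<in> euclid I"
      using insert.prems v by (auto simp: euclid_def)
    have "(\<lambda>b. if b \<in> insert a J then v b else 0) = (\<lambda>b. v a * ?e b + ?u b)"
      using insert.hyps by auto
    then have "\<phi> (\<lambda>b. if b \<in> insert a J then v b else 0) = v a * \<phi> ?e + \<phi> ?u"
      using add[OF m(3,1)] scale[OF m(2)] by simp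
    then show ?case using insert by simp
  qed
  from this[OF I subset_refl] have
    "\<phi> (\<lambda>b. if b \<in> I then v b else 0) = (\<Sum>a\<in>I. v a * \<phi> (\<lambda>b. if b = a then 1 else 0))" .
  moreover have "(\<lambda>b. if b \<in> I then v b else 0) = v"
    using v by (auto simp: euclid_def)
  ultimately show ?thesis by (simp only:)
qed

lemma linear_on_euclid_bounded:
  assumes I: "finite I" and h: "linear_on_euclid I h"
  obtains C where "0 \<le> C" "\<And>v. v \<in> euclid I \<Longrightarrow> L2_set (h v) I \<le> C * L2_set v I"
proof
  let ?e = "\<lambda>a b. if b = a then 1 else 0 :: real"
  let ?C = "\<Sum>b\<in>I. \<Sum>a\<in>I. \<bar>h (?e a) b\<bar>"
  show "0 \<le> ?C" by (intro sum_nonneg) auto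
  fix v assume v: "v \<in> euclid I"
  have "\<bar>h v b\<bar> \<le> (\<Sum>a\<in>I. \<bar>h (?e a) b\<bar>) * L2_set v I" for b
  proof -
    have "h v b = (\<Sum>a\<in>I. v a * h (?e a) b)"
      by (rule functional_expand[OF I v]) (use h in \<open>auto simp: linear_on_euclid_def\<close>)
    also have "\<bar>\<dots>\<bar> \<le> (\<Sum>a\<in>I. \<bar>v a\<bar> * \<bar>h (?e a) b\<bar>)"
      using sum_abs[of "\<lambda>a. v a * h (?e a) b" I] by (simp add: abs_mult)
    also have "\<dots> \<le> (\<Sum>a\<in>I. L2_set v I * \<bar>h (?e a) b\<bar>)"
    proof (intro sum_mono mult_right_mono)
      fix a assume "a \<in> I"
      have "\<bar>v a\<bar> \<le> L2_set (\<lambda>a. \<bar>v a\<bar>) I" by (rule member_le_L2_set[OF I \<open>a \<in> I\<close>])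
      then show "\<bar>v a\<bar> \<le> L2_set v I" by (simp add: L2_set_def)
    qed auto
    finally show ?thesis by (simp add: sum_distrib_left mult.commute)
  qed
  then have "(\<Sum>b\<in>I. \<bar>h v b\<bar>) \<le> (\<Sum>b\<in>I. (\<Sum>a\<in>I. \<bar>h (?e a) b\<bar>) * L2_set v I)"
    by (intro sum_mono)
  also have "\<dots> = ?C * L2_set v I" by (simp only: sum_distrib_right)
  finally show "L2_set (h v) I \<le> ?C * L2_set v I"
    using L2_set_le_sum_abs[of "h v" I] by linarith
qed

lemma op_norm_le:
  assumes "0 \<le> c" "\<And>v. v \<in> euclid I \<Longrightarrow> L2_set (h v) I \<le> c * L2_set v I"
  shows "op_norm I h \<le> c"
  unfolding op_norm_def
proof (rule cSUP_least)
  show "euclid I \<noteq> {}" by (auto simp: euclid_def)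
  fix v assume "v \<in> euclid I"
  then show "L2_set (h v) I / L2_set v I \<le> c"
    using assms by (cases "L2_set v I = 0") (auto simp: divide_le_eq less_le)
qed

lemma op_norm:
  assumes I: "finite I" and h: "linear_on_euclid I h"
  shows "0 \<le> op_norm I h" and "v \<in> euclid I \<Longrightarrow> L2_set (h v) I \<le> op_norm I h * L2_set v I"
proof -
  obtain C where C: "0 \<le> C" "\<And>v. v \<in> euclid I \<Longrightarrow> L2_set (h v) I \<le> C * L2_set v I"
    using linear_on_euclid_bounded[OF assms] by blast
  have bdd: "bdd_above ((\<lambda>v. L2_set (h v) I / L2_set v I) ` euclid I)"
  proof (rule bdd_aboveI2)
    fix v assume "v \<in> euclid I"
    then show "L2_set (h v) I / L2_set v I \<le> C"
      using C by (cases "L2_set v I = 0") (auto simp: divide_le_eq less_le)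
  qed
  have z: "(\<lambda>a. 0) \<in> euclid I" by (simp add: euclid_def)
  have "L2_set (h (\<lambda>a. 0)) I / L2_set (\<lambda>a. 0 :: real) I \<le> op_norm I h"
    unfolding op_norm_def using bdd z by (rule cSUP_upper[rotated])
  then show "0 \<le> op_norm I h" by (simp add: L2_set_def)
  assume v: "v \<in> euclid I"
  have "L2_set (h v) I / L2_set v I \<le> op_norm I h"
    unfolding op_norm_def using bdd v by (rule cSUP_upper[rotated])
  then show "L2_set (h v) I \<le> op_norm I h * L2_set v I"
    using C(2)[OF v] L2_set_nonneg[of "h v" I] L2_set_nonneg[of v I]
    by (cases "L2_set v I = 0") (auto simp: divide_le_eq less_le)
qed

lemma linear_on_euclid_diff:
  assumes "f \<in> carrier (GL I)" "g \<in> carrier (GL I)"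
  shows "linear_on_euclid I (\<lambda>v a. f v a - g v a)"
  using assms by (auto simp: carrier_GL linear_on_euclid_def algebra_simps)

lemma Metric_space_GL:
  assumes I: "finite I"
  shows "Metric_space (carrier (GL I)) (GL_dist I)"
proof
  show "0 \<le> GL_dist I f g" for f g
    using op_norm(1)[OF I linear_on_euclid_diff] by (auto simp: GL_dist_def)
  have sym: "L2_set (\<lambda>a. p a - q a) I = L2_set (\<lambda>a. q a - p a) I" for p q :: "_ \<Rightarrow> real"
    by (simp add: L2_set_def power2_commute)
  show "GL_dist I f g = GL_dist I g f" for f g
    by (auto simp: GL_dist_def op_norm_def sym[of "f _" "g _"])
  show "GL_dist I f g = 0 \<longleftrightarrow> f = g" if fg: "f \<in> carrier (GL I)" "g \<in> carrier (GL I)" for f g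
  proof
    assume "GL_dist I f g = 0"
    then have 0: "op_norm I (\<lambda>v a. f v a - g v a) = 0" using fg by (simp add: GL_dist_def)
    show "f = g"
    proof (rule extensionalityI[of _ "euclid I"])
      show "f \<in> extensional (euclid I)" "g \<in> extensional (euclid I)"
        using fg by (auto simp: carrier_GL)
      fix v assume v: "v \<in> euclid I"
      have "L2_set (\<lambda>a. f v a - g v a) I \<le> 0"
        using op_norm(2)[OF I linear_on_euclid_diff[OF fg] v] 0 by simp
      then have "L2_set (\<lambda>a. f v a - g v a) I = 0" by (metis L2_set_nonneg antisym)
      then have "\<forall>a\<in>I. f v a = g v a" using I by (simp add: L2_set_eq_0_iff)
      moreover have "\<forall>a. a \<notin> I \<longrightarrow> f v a = g v a"
        using carrier_GL_closed[OF fg(1) v] carrier_GL_closed[OF fg(2) v] by (simp add: euclid_def)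
      ultimately show "f v = g v" by blast
    qed
  next
    assume "f = g"
    have "op_norm I (\<lambda>v a. 0) = 0"
      using op_norm_le[of 0 I "\<lambda>v a. 0"] op_norm(1)[OF I, of "\<lambda>v a. 0"]
      by (simp add: L2_set_0' linear_on_euclid_def)
    then show "GL_dist I f g = 0" using \<open>f = g\<close> by (simp add: GL_dist_def)
  qed
  show "GL_dist I f h \<le> GL_dist I f g + GL_dist I g h"
    if fgh: "f \<in> carrier (GL I)" "g \<in> carrier (GL I)" "h \<in> carrier (GL I)" for f g h
  proof -
    let ?p = "\<lambda>v a. f v a - g v a" and ?q = "\<lambda>v a. g v a - h v a"
    note p = linear_on_euclid_diff[OF fgh(1,2)] and q = linear_on_euclid_diff[OF fgh(2,3)]
    have "op_norm I (\<lambda>v a. f v a - h v a) \<le> op_norm I ?p + op_norm I ?q"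
    proof (rule op_norm_le)
      show "0 \<le> op_norm I ?p + op_norm I ?q" using op_norm(1)[OF I p] op_norm(1)[OF I q] by simp
      fix v assume v: "v \<in> euclid I"
      have "L2_set (\<lambda>a. f v a - h v a) I = L2_set (\<lambda>a. ?p v a + ?q v a) I" by simp
      also have "\<dots> \<le> L2_set (?p v) I + L2_set (?q v) I" by (rule L2_set_triangle_ineq)
      also have "\<dots> \<le> (op_norm I ?p + op_norm I ?q) * L2_set v I"
        using op_norm(2)[OF I p v] op_norm(2)[OF I q v] by (simp add: distrib_right)
      finally show "L2_set (\<lambda>a. f v a - h v a) I \<le> (op_norm I ?p + op_norm I ?q) * L2_set v I" .
    qed
    then show ?thesis using fgh by (simp add: GL_dist_def)
  qed
qed

lemma topspace_GL_tensor: "topspace (GL_tensor_topology l d) = carrier (GL_tensor l d)"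
  using Metric_space.topspace_mtopology[OF Metric_space_GL[OF finite_multi_indices[of l d]]]
  by (auto simp: GL_tensor_topology_def GL_topology_def GL_tensor_def)

lemma ip_H_tensor: "ip_H l d (tensor l d x) (tensor l d y) = (\<Prod>i<l. ip {..<d i} (x i) (y i))"
proof -
  have "(\<Prod>i<l. ip {..<d i} (x i) (y i)) =
      (\<Sum>\<alpha>\<in>multi_indices l d. \<Prod>i<l. x i (\<alpha> i) * y i (\<alpha> i))"
    unfolding ip_def multi_indices_def by (rule prod_sum_PiE) auto
  then show ?thesis by (simp add: ip_def tensor_def prod.distrib)
qed

lemma unit_tensor:
  assumes \<alpha>: "\<alpha> \<in> multi_indices l d"
  shows "tensor l d (\<lambda>i j. if j = \<alpha> i then 1 else 0) = (\<lambda>\<beta>. if \<beta> = \<alpha> then 1 else 0)"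
proof
  fix \<beta>
  have "\<alpha> = \<beta>" if "\<beta> \<in> multi_indices l d" "\<forall>i<l. \<beta> i = \<alpha> i"
    using that \<alpha> unfolding multi_indices_def by (metis PiE_ext lessThan_iff)
  then show "tensor l d (\<lambda>i j. if j = \<alpha> i then 1 else 0) \<beta> = (if \<beta> = \<alpha> then 1 else 0)"
    using \<alpha> by (auto simp: tensor_def)
qed

lemma ip_H_unique:
  fixes B :: "((nat \<Rightarrow> nat) \<Rightarrow> real) \<Rightarrow> ((nat \<Rightarrow> nat) \<Rightarrow> real) \<Rightarrow> real"
  assumes add1: "\<And>S S' T. S \<in> tensor_space l d \<Longrightarrow> S' \<in> tensor_space l d \<Longrightarrow> T \<in> tensor_space l d \<Longrightarrow>
        B (\<lambda>\<alpha>. S \<alpha> + S' \<alpha>) T = B S T + B S' T"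
    and scale1: "\<And>c S T. S \<in> tensor_space l d \<Longrightarrow> T \<in> tensor_space l d \<Longrightarrow>
        B (\<lambda>\<alpha>. c * S \<alpha>) T = c * B S T"
    and add2: "\<And>S T T'. S \<in> tensor_space l d \<Longrightarrow> T \<in> tensor_space l d \<Longrightarrow> T' \<in> tensor_space l d \<Longrightarrow>
        B S (\<lambda>\<alpha>. T \<alpha> + T' \<alpha>) = B S T + B S T'"
    and scale2: "\<And>c S T. S \<in> tensor_space l d \<Longrightarrow> T \<in> tensor_space l d \<Longrightarrow>
        B S (\<lambda>\<alpha>. c * T \<alpha>) = c * B S T"
    and tensor: "\<And>x y. \<forall>i<l. x i \<in> euclid {..<d i} \<and> y i \<in> euclid {..<d i} \<Longrightarrow>
        B (tensor l d x) (tensor l d y) = (\<Prod>i<l. ip {..<d i} (x i) (y i))"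
    and S: "S \<in> tensor_space l d" and T: "T \<in> tensor_space l d"
  shows "B S T = ip_H l d S T"
proof -
  let ?I = "multi_indices l d" and ?e = "\<lambda>\<alpha> \<beta> :: nat \<Rightarrow> nat. if \<beta> = \<alpha> then 1 else 0 :: real"
  note fin = finite_multi_indices[of l d]
  have e: "?e \<alpha> \<in> tensor_space l d" if "\<alpha> \<in> ?I" for \<alpha>
    using that by (auto simp: euclid_def)
  have B_e: "B (?e \<alpha>) (?e \<beta>) = (if \<beta> = \<alpha> then 1 else 0)" if ab: "\<alpha> \<in> ?I" "\<beta> \<in> ?I" for \<alpha> \<beta>
  proof -
    have "\<forall>i<l. (\<lambda>j. if j = \<alpha> i then 1 else 0) \<in> euclid {..<d i} \<and>
        (\<lambda>j. if j = \<beta> i then 1 else 0) \<in> euclid {..<d i}"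
      using ab by (auto simp: euclid_def multi_indices_def PiE_def Pi_def)
    then have "B (?e \<alpha>) (?e \<beta>) = ip_H l d (?e \<alpha>) (?e \<beta>)"
      using tensor[of "\<lambda>i j. if j = \<alpha> i then 1 else 0" "\<lambda>i j. if j = \<beta> i then 1 else 0"]
        ip_H_tensor[of l d "\<lambda>i j. if j = \<alpha> i then 1 else 0" "\<lambda>i j. if j = \<beta> i then 1 else 0"]
      by (simp only: unit_tensor[OF ab(1)] unit_tensor[OF ab(2)])
    also have "\<dots> = (\<Sum>\<gamma>\<in>?I. if \<gamma> = \<alpha> then ?e \<beta> \<gamma> else 0)"
      unfolding ip_def by (rule sum.cong) auto
    also have "\<dots> = (if \<beta> = \<alpha> then 1 else 0)" using fin ab by auto
    finally show ?thesis .
  qed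
  have "B S T = (\<Sum>\<alpha>\<in>?I. S \<alpha> * B (?e \<alpha>) T)"
    by (rule functional_expand[OF fin S]) (use add1 scale1 T in auto)
  also have "\<dots> = (\<Sum>\<alpha>\<in>?I. S \<alpha> * (\<Sum>\<beta>\<in>?I. T \<beta> * B (?e \<alpha>) (?e \<beta>)))"
  proof (rule sum.cong[OF refl])
    fix \<alpha> assume "\<alpha> \<in> ?I"
    have "B (?e \<alpha>) T = (\<Sum>\<beta>\<in>?I. T \<beta> * B (?e \<alpha>) (?e \<beta>))"
      by (rule functional_expand[OF fin T]) (use add2 scale2 e[OF \<open>\<alpha> \<in> ?I\<close>] in auto)
    then show "S \<alpha> * B (?e \<alpha>) T = S \<alpha> * (\<Sum>\<beta>\<in>?I. T \<beta> * B (?e \<alpha>) (?e \<beta>))" by simp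
  qed
  also have "\<dots> = (\<Sum>\<alpha>\<in>?I. S \<alpha> * (\<Sum>\<beta>\<in>?I. T \<beta> * (if \<beta> = \<alpha> then 1 else 0)))"
    by (simp add: B_e)
  also have "\<dots> = ip_H l d S T"
    using fin by (simp add: ip_def mult_delta_right)
  finally show ?thesis .
qed

end

theory Submission
  imports Defs "HOL-Number_Theory.Cong"
begin

text \<open>
  A compact submonoid of \<open>GL\<close> is closed under inverses, because \<open>f\<^sup>-\<^sup>1\<close> is a limit point of the powers
  of \<open>f\<close>; so it is never needed that the inverse of a decomposability-preserving isomorphism
  preserves decomposability. Let \<open>K \<supseteq> O_tensor\<close> be a compact subgroup, \<open>N\<close> the dimension of the
  tensor space and \<open>M\<close> the supremum of the squared Frobenius norm on \<open>K\<close>. The tensor products of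
  signed cyclic shifts form a finite subset of \<open>O_tensor\<close>, and the average of \<open>\<parallel>f h g\<parallel>\<^sup>2\<close> over these \<open>h\<close>
  is \<open>\<parallel>f\<parallel>\<^sup>2 \<parallel>g\<parallel>\<^sup>2 / N\<close>. Hence \<open>\<parallel>f\<parallel>\<^sup>2 M \<le> N M\<close> for \<open>f \<in> K\<close>, that is \<open>\<parallel>f\<parallel>\<^sup>2 \<le> N\<close>. The same bound for
  \<open>f\<^sup>-\<^sup>1\<close> together with \<open>tr (f f\<^sup>-\<^sup>1) = N\<close> gives equality in the Cauchy-Schwarz inequality, so \<open>f\<^sup>-\<^sup>1\<close> is
  the transpose of \<open>f\<close>.
\<close>

section \<open>Matrix entries and compact sets of linear maps\<close>

definition unit_vec :: "'i \<Rightarrow> 'i \<Rightarrow> real"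
  where "unit_vec b = (\<lambda>a. if a = b then 1 else 0)"

definition entry :: "(('i \<Rightarrow> real) \<Rightarrow> ('i \<Rightarrow> real)) \<Rightarrow> 'i \<Rightarrow> 'i \<Rightarrow> real"
  where "entry f a b = f (unit_vec b) a"

lemma unit_vec_in_euclid [simp]: "b \<in> I \<Longrightarrow> unit_vec b \<in> euclid I"
  by (auto simp: unit_vec_def euclid_def)

lemma linear_on_euclid_entry_expand:
  assumes "finite I" "linear_on_euclid I f" "v \<in> euclid I"
  shows "f v a = (\<Sum>b\<in>I. v b * entry f a b)"
  unfolding entry_def unit_vec_def
  by (rule functional_expand[where \<phi> = "\<lambda>v. f v a"]) (use assms in \<open>auto simp: linear_on_euclid_def\<close>)

lemma GL_entry_expand:
  assumes "finite I" "f \<in> carrier (GL I)" "v \<in> euclid I"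
  shows "f v a = (\<Sum>b\<in>I. v b * entry f a b)"
  using assms by (auto simp: carrier_GL intro: linear_on_euclid_entry_expand)

lemma GL_eqI:
  assumes I: "finite I" and f: "f \<in> carrier (GL I)" and g: "g \<in> carrier (GL I)"
    and eq: "\<And>a b. a \<in> I \<Longrightarrow> b \<in> I \<Longrightarrow> entry f a b = entry g a b"
  shows "f = g"
\<comment> \<open>Membership in \<open>GL I\<close> already fixes the values off
  \<open>euclid I\<close> (by extensionality) and the coordinates outside \<open>I\<close> (they
  vanish), so only the coordinates in \<open>I\<close> remain to be compared.\<close>
proof (rule extensionalityI[of _ "euclid I"])
  show "f \<in> extensional (euclid I)" "g \<in> extensional (euclid I)"
    using f g by (auto simp: carrier_GL)
  fix v assume v: "v \<in> euclid I"
  show "f v = g v"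
  proof
    fix a
    show "f v a = g v a"
    proof (cases "a \<in> I")
      case True
      then show ?thesis by (simp add: GL_entry_expand[OF I _ v] f g eq)
    next
      case False
      then show ?thesis
        using carrier_GL_closed[OF f v] carrier_GL_closed[OF g v] by (simp add: euclid_def)
    qed
  qed
qed

lemma mult_GL: "f \<in> carrier (GL I) \<Longrightarrow> g \<in> carrier (GL I) \<Longrightarrow> f \<otimes>\<^bsub>GL I\<^esub> g = compose (euclid I) f g"
  by (auto simp: GL_def BijGroup_def)

lemma one_GL: "\<one>\<^bsub>GL I\<^esub> = restrict (\<lambda>v. v) (euclid I)"
  by (simp add: GL_def BijGroup_def)

lemma entry_one: "b \<in> I \<Longrightarrow> entry \<one>\<^bsub>GL I\<^esub> a b = (if a = b then 1 else 0)"
  by (simp add: entry_def one_GL) (simp add: unit_vec_def)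

lemma entry_mult:
  assumes "finite I" "f \<in> carrier (GL I)" "g \<in> carrier (GL I)" "c \<in> I"
  shows "entry (f \<otimes>\<^bsub>GL I\<^esub> g) a c = (\<Sum>b\<in>I. entry f a b * entry g b c)"
proof -
  have "g (unit_vec c) \<in> euclid I"
    using assms by (simp add: carrier_GL_closed)
  then have "f (g (unit_vec c)) a = (\<Sum>b\<in>I. g (unit_vec c) b * entry f a b)"
    using assms by (intro GL_entry_expand) auto
  then show ?thesis
    using assms by (simp add: entry_def mult_GL compose_eq mult.commute)
qed

section \<open>The operator norm metric compared with matrix entries\<close>

lemma abs_le_L2_set: "finite I \<Longrightarrow> a \<in> I \<Longrightarrow> \<bar>v a\<bar> \<le> L2_set v I"
  using member_le_L2_set[of I a "\<lambda>a. \<bar>v a\<bar>"] by (simp add: L2_set_def)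

lemma L2_set_unit_vec: "finite I \<Longrightarrow> b \<in> I \<Longrightarrow> L2_set (unit_vec b) I = 1"
  by (simp add: L2_set_def unit_vec_def if_distrib[of "\<lambda>x. x\<^sup>2"] cong: if_cong)

text \<open>An entry is one coordinate of the image of a vector of norm 1, so the operator norm of
  the difference dominates it. With the reverse estimate that follows, convergence in
  \<open>GL_topology\<close> becomes convergence of all entries.\<close>

lemma abs_entry_diff_le_GL_dist:
  assumes I: "finite I" and f: "f \<in> carrier (GL I)" and g: "g \<in> carrier (GL I)"
    and a: "a \<in> I" and b: "b \<in> I"
  shows "\<bar>entry f a b - entry g a b\<bar> \<le> GL_dist I f g"
proof -
  let ?h = "\<lambda>v a. f v a - g v a"
  have "\<bar>entry f a b - entry g a b\<bar> \<le> L2_set (?h (unit_vec b)) I"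
    using abs_le_L2_set[OF I a, of "?h (unit_vec b)"] by (simp add: entry_def)
  also have "\<dots> \<le> op_norm I ?h * L2_set (unit_vec b) I"
    by (rule op_norm(2)[OF I linear_on_euclid_diff[OF f g]]) (simp add: b)
  finally show ?thesis using f g by (simp add: L2_set_unit_vec I b GL_dist_def)
qed

lemma GL_dist_le_sum_entries:
  assumes I: "finite I" and f: "f \<in> carrier (GL I)" and g: "g \<in> carrier (GL I)"
  shows "GL_dist I f g \<le> (\<Sum>a\<in>I. \<Sum>b\<in>I. \<bar>entry f a b - entry g a b\<bar>)"
proof -
  let ?h = "\<lambda>v a. f v a - g v a"
  let ?C = "\<Sum>a\<in>I. \<Sum>b\<in>I. \<bar>entry f a b - entry g a b\<bar>"
  have "op_norm I ?h \<le> ?C"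
  proof (rule op_norm_le)
    show "0 \<le> ?C" by (intro sum_nonneg) auto
    fix v assume v: "v \<in> euclid I"
    have "\<bar>?h v a\<bar> \<le> (\<Sum>b\<in>I. \<bar>entry f a b - entry g a b\<bar>) * L2_set v I" for a
    proof -
      have "?h v a = (\<Sum>b\<in>I. v b * (entry f a b - entry g a b))"
        by (simp add: GL_entry_expand[OF I _ v] f g sum_subtractf right_diff_distrib)
      also have "\<bar>\<dots>\<bar> \<le> (\<Sum>b\<in>I. \<bar>v b\<bar> * \<bar>entry f a b - entry g a b\<bar>)"
        using sum_abs[of "\<lambda>b. v b * (entry f a b - entry g a b)" I] by (simp add: abs_mult)
      also have "\<dots> \<le> (\<Sum>b\<in>I. L2_set v I * \<bar>entry f a b - entry g a b\<bar>)"
        by (intro sum_mono mult_right_mono abs_le_L2_set I) auto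
      finally show ?thesis by (simp add: sum_distrib_left mult.commute)
    qed
    then have "(\<Sum>a\<in>I. \<bar>?h v a\<bar>) \<le> (\<Sum>a\<in>I. (\<Sum>b\<in>I. \<bar>entry f a b - entry g a b\<bar>) * L2_set v I)"
      by (intro sum_mono)
    also have "\<dots> = ?C * L2_set v I" by (simp only: sum_distrib_right)
    finally show "L2_set (?h v) I \<le> ?C * L2_set v I"
      using L2_set_le_sum_abs[of "?h v" I] by linarith
  qed
  then show ?thesis using f g by (simp add: GL_dist_def)
qed

lemma limitin_GL_iff:
  assumes I: "finite I" and \<sigma>: "range \<sigma> \<subseteq> carrier (GL I)" and f: "f \<in> carrier (GL I)"
  shows "limitin (GL_topology I) \<sigma> f sequentially \<longleftrightarrow>
    (\<forall>a\<in>I. \<forall>b\<in>I. (\<lambda>n. entry (\<sigma> n) a b) \<longlonglongrightarrow> entry f a b)"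
proof -
  interpret M: Metric_space "carrier (GL I)" "GL_dist I" by (rule Metric_space_GL[OF I])
  have \<sigma>': "\<sigma> n \<in> carrier (GL I)" for n using \<sigma> by auto
  have "limitin (GL_topology I) \<sigma> f sequentially \<longleftrightarrow> (\<lambda>n. GL_dist I (\<sigma> n) f) \<longlonglongrightarrow> 0"
    unfolding GL_topology_def M.limitin_metric_dist_null using f \<sigma>' by auto
  also have "\<dots> \<longleftrightarrow> (\<forall>a\<in>I. \<forall>b\<in>I. (\<lambda>n. entry (\<sigma> n) a b) \<longlonglongrightarrow> entry f a b)"
  proof (intro iffI ballI)
    fix a b assume 0: "(\<lambda>n. GL_dist I (\<sigma> n) f) \<longlonglongrightarrow> 0" and ab: "a \<in> I" "b \<in> I"
    have "(\<lambda>n. entry (\<sigma> n) a b - entry f a b) \<longlonglongrightarrow> 0"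
      by (rule Lim_null_comparison[OF _ 0])
        (simp add: abs_entry_diff_le_GL_dist[OF I \<sigma>' f ab])
    then show "(\<lambda>n. entry (\<sigma> n) a b) \<longlonglongrightarrow> entry f a b" by (simp add: LIM_zero_iff)
  next
    assume lim: "\<forall>a\<in>I. \<forall>b\<in>I. (\<lambda>n. entry (\<sigma> n) a b) \<longlonglongrightarrow> entry f a b"
    have "(\<lambda>n. \<Sum>a\<in>I. \<Sum>b\<in>I. \<bar>entry (\<sigma> n) a b - entry f a b\<bar>) \<longlonglongrightarrow>
        (\<Sum>a\<in>I. \<Sum>b\<in>I. \<bar>entry f a b - entry f a b\<bar>)"
      using lim by (intro tendsto_intros) auto
    then have "(\<lambda>n. \<Sum>a\<in>I. \<Sum>b\<in>I. \<bar>entry (\<sigma> n) a b - entry f a b\<bar>) \<longlonglongrightarrow> 0" by simp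
    then show "(\<lambda>n. GL_dist I (\<sigma> n) f) \<longlonglongrightarrow> 0"
      by (rule Lim_null_comparison[rotated])
        (simp add: GL_dist_le_sum_entries[OF I \<sigma>' f])
  qed
  finally show ?thesis .
qed

text \<open>In a metric space compactness is sequential compactness; together with
  \<open>limitin_GL_iff\<close> this turns it into a statement about sequences of matrices.\<close>

lemma compactin_GL_iff:
  assumes I: "finite I"
  shows "compactin (GL_topology I) K \<longleftrightarrow> K \<subseteq> carrier (GL I) \<and>
    (\<forall>\<sigma>. range \<sigma> \<subseteq> K \<longrightarrow> (\<exists>f r. f \<in> K \<and> strict_mono (r :: nat \<Rightarrow> nat) \<and>
      (\<forall>a\<in>I. \<forall>b\<in>I. (\<lambda>n. entry (\<sigma> (r n)) a b) \<longlonglongrightarrow> entry f a b)))"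
proof (cases "K \<subseteq> carrier (GL I)")
  case True
  interpret M: Metric_space "carrier (GL I)" "GL_dist I" by (rule Metric_space_GL[OF I])
  have "limitin M.mtopology (\<sigma> \<circ> r) f sequentially \<longleftrightarrow>
      (\<forall>a\<in>I. \<forall>b\<in>I. (\<lambda>n. entry (\<sigma> (r n)) a b) \<longlonglongrightarrow> entry f a b)"
    if "range \<sigma> \<subseteq> K" "f \<in> K" for \<sigma> f and r :: "nat \<Rightarrow> nat"
  proof -
    have "range (\<sigma> \<circ> r) \<subseteq> carrier (GL I)" "f \<in> carrier (GL I)" using that True by auto
    from limitin_GL_iff[OF I this] show ?thesis by (simp add: GL_topology_def)
  qed
  then show ?thesis
    unfolding GL_topology_def M.compactin_sequentially using True by (smt (verit, best))
next
  case False
  interpret M: Metric_space "carrier (GL I)" "GL_dist I" by (rule Metric_space_GL[OF I])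
  show ?thesis unfolding GL_topology_def M.compactin_sequentially using False by blast
qed

lemma compactin_GL_bounded_entries:
  assumes I: "finite I" and K: "compactin (GL_topology I) K"
  obtains B where "\<And>f a b. f \<in> K \<Longrightarrow> a \<in> I \<Longrightarrow> b \<in> I \<Longrightarrow> \<bar>entry f a b\<bar> \<le> B"
proof (cases "K = {}")
  case False
  interpret M: Metric_space "carrier (GL I)" "GL_dist I" by (rule Metric_space_GL[OF I])
  from False obtain g where g: "g \<in> K" by blast
  from M.compactin_imp_mbounded[of K] K obtain B
    where KM: "K \<subseteq> carrier (GL I)" and B: "\<And>f g. f \<in> K \<Longrightarrow> g \<in> K \<Longrightarrow> GL_dist I f g \<le> B"
    unfolding M.mbounded_alt GL_topology_def by auto
  show thesis
  proof (rule that)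
    fix f a b assume "f \<in> K" "a \<in> I" "b \<in> I"
    \<comment> \<open>\<open>B\<close> bounds only distances within \<open>K\<close>. The sum of the
      absolute values of all entries of the fixed \<open>g\<close> turns it into a bound on entries
      that is uniform in \<open>a\<close> and \<open>b\<close>.\<close>
    moreover from this have "\<bar>entry g a b\<bar> \<le> (\<Sum>a\<in>I. \<Sum>b\<in>I. \<bar>entry g a b\<bar>)"
      using member_le_sum[of a I "\<lambda>a. \<Sum>b\<in>I. \<bar>entry g a b\<bar>"]
        member_le_sum[of b I "\<lambda>b. \<bar>entry g a b\<bar>"] I by (fastforce intro: sum_nonneg)
    ultimately show "\<bar>entry f a b\<bar> \<le> B + (\<Sum>a\<in>I. \<Sum>b\<in>I. \<bar>entry g a b\<bar>)"
      using abs_entry_diff_le_GL_dist[OF I, of f g a b] B[of f g] g KM by force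
  qed
qed (use that in auto)

section \<open>Inverses in compact submonoids\<close>

text \<open>
  If \<open>f\<^bsup>r n\<^esup>\<close> converges to \<open>g\<close>, then any limit point \<open>h\<close> of \<open>f\<^bsup>r (n + 1) - r n - 1\<^esup>\<close> satisfies
  \<open>g f h = g\<close>.
\<close>

lemma compact_submonoid_inv_closed:
  assumes I: "finite I" and K: "compactin (GL_topology I) K"
    and one: "\<one>\<^bsub>GL I\<^esub> \<in> K" and mult: "\<And>f g. f \<in> K \<Longrightarrow> g \<in> K \<Longrightarrow> f \<otimes>\<^bsub>GL I\<^esub> g \<in> K"
    and f: "f \<in> K"
  shows "inv\<^bsub>GL I\<^esub> f \<in> K"
proof -
  interpret group "GL I" by (rule group_GL)
  note K' = K[unfolded compactin_GL_iff[OF I]]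
  have KG: "K \<subseteq> carrier (GL I)" using K' by blast
  have pow: "f [^]\<^bsub>GL I\<^esub> n \<in> K" for n :: nat
    by (induction n) (auto simp: one mult f)
  obtain g r where g: "g \<in> K" and r: "strict_mono (r :: nat \<Rightarrow> nat)"
    and lim_g: "\<forall>a\<in>I. \<forall>b\<in>I. (\<lambda>n. entry (f [^]\<^bsub>GL I\<^esub> r n) a b) \<longlonglongrightarrow> entry g a b"
    using K'[THEN conjunct2, rule_format, of "\<lambda>n. f [^]\<^bsub>GL I\<^esub> n"] pow by auto
  \<comment> \<open>One factor \<open>f\<close> is set apart:
    \<open>r (Suc n) = r n + 1 + e n\<close>. Strict monotonicity of \<open>r\<close> makes the
    truncated subtraction exact, and \<open>e n\<close> may be 0.\<close>
  define e where "e n = r (Suc n) - r n - 1" for n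
  obtain h t where h: "h \<in> K" and t: "strict_mono (t :: nat \<Rightarrow> nat)"
    and lim_h: "\<forall>a\<in>I. \<forall>b\<in>I. (\<lambda>n. entry (f [^]\<^bsub>GL I\<^esub> e (t n)) a b) \<longlonglongrightarrow> entry h a b"
    using K'[THEN conjunct2, rule_format, of "\<lambda>n. f [^]\<^bsub>GL I\<^esub> e n"] pow by auto
  have fC: "f \<in> carrier (GL I)" and gC: "g \<in> carrier (GL I)" and hC: "h \<in> carrier (GL I)"
    using f g h KG by auto
  have split: "f [^]\<^bsub>GL I\<^esub> r (Suc (t n)) = f [^]\<^bsub>GL I\<^esub> r (t n) \<otimes>\<^bsub>GL I\<^esub> (f \<otimes>\<^bsub>GL I\<^esub> f [^]\<^bsub>GL I\<^esub> e (t n))" for n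
  proof -
    have "r (Suc (t n)) = r (t n) + Suc (e (t n))"
      using r by (simp add: e_def strict_mono_Suc_iff Suc_le_eq Suc_diff_Suc less_imp_le)
    then show ?thesis using fC by (simp only: nat_pow_mult[symmetric] nat_pow_Suc2)
  qed
  have "g = g \<otimes>\<^bsub>GL I\<^esub> (f \<otimes>\<^bsub>GL I\<^esub> h)"
  proof (rule GL_eqI[OF I])
    fix a c assume a: "a \<in> I" and c: "c \<in> I"
    have "(\<lambda>n. \<Sum>b\<in>I. entry (f [^]\<^bsub>GL I\<^esub> r (t n)) a b *
          (\<Sum>x\<in>I. entry f b x * entry (f [^]\<^bsub>GL I\<^esub> e (t n)) x c)) \<longlonglongrightarrow>
        (\<Sum>b\<in>I. entry g a b * (\<Sum>x\<in>I. entry f b x * entry h x c))"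
    proof (intro tendsto_intros)
      show "(\<lambda>n. entry (f [^]\<^bsub>GL I\<^esub> r (t n)) a b) \<longlonglongrightarrow> entry g a b" if "b \<in> I" for b
        using LIMSEQ_subseq_LIMSEQ[OF lim_g[rule_format, OF a that] t] by (simp add: o_def)
    qed (use lim_h c in auto)
    then have "(\<lambda>n. entry (f [^]\<^bsub>GL I\<^esub> r (Suc (t n))) a c) \<longlonglongrightarrow>
        entry (g \<otimes>\<^bsub>GL I\<^esub> (f \<otimes>\<^bsub>GL I\<^esub> h)) a c"
      by (simp add: split entry_mult I fC gC hC c)
    \<comment> \<open>The exponents \<open>r (Suc (t n))\<close> also form a subsequence of
      \<open>r\<close>, so the same powers tend to \<open>g\<close>.\<close>
    moreover have "(\<lambda>n. entry (f [^]\<^bsub>GL I\<^esub> r (Suc (t n))) a c) \<longlonglongrightarrow> entry g a c"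
      using LIMSEQ_subseq_LIMSEQ[OF lim_g[rule_format, OF a c], of "\<lambda>n. Suc (t n)"] t
      by (simp add: o_def strict_mono_def)
    ultimately show "entry g a c = entry (g \<otimes>\<^bsub>GL I\<^esub> (f \<otimes>\<^bsub>GL I\<^esub> h)) a c"
      by (rule LIMSEQ_unique[symmetric])
  qed (auto simp: fC gC hC)
  then have "f \<otimes>\<^bsub>GL I\<^esub> h = \<one>\<^bsub>GL I\<^esub>"
    using fC gC hC by (metis m_closed r_cancel_one' l_cancel_one')
  then show ?thesis using h fC hC by (metis inv_unique' inv_equality inv_comm)
qed

section \<open>Orthogonal matrices\<close>

lemma ip_unit_vec: "finite I \<Longrightarrow> b \<in> I \<Longrightarrow> ip I (unit_vec b) (unit_vec c) = (if b = c then 1 else 0)"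
  by (simp add: ip_def unit_vec_def if_distrib[of "\<lambda>x. x * _"] cong: if_cong)

text \<open>By bilinearity it suffices to test unit vectors, whose images are the columns of the
  matrix.\<close>

lemma preserves_ip_iff_entries:
  assumes I: "finite I" and f: "f \<in> carrier (GL I)"
  shows "(\<forall>u\<in>euclid I. \<forall>v\<in>euclid I. ip I (f u) (f v) = ip I u v) \<longleftrightarrow>
    (\<forall>b\<in>I. \<forall>c\<in>I. (\<Sum>a\<in>I. entry f a b * entry f a c) = (if b = c then 1 else 0))"
    (is "?L \<longleftrightarrow> ?R")
proof
  assume L: ?L
  show ?R
  proof (intro ballI)
    fix b c assume bc: "b \<in> I" "c \<in> I"
    have "(\<Sum>a\<in>I. entry f a b * entry f a c) = ip I (f (unit_vec b)) (f (unit_vec c))"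
      by (simp add: ip_def entry_def)
    also have "\<dots> = (if b = c then 1 else 0)" using L bc by (simp add: ip_unit_vec I)
    finally show "(\<Sum>a\<in>I. entry f a b * entry f a c) = (if b = c then 1 else 0)" .
  qed
next
  assume R: ?R
  show ?L
  proof (intro ballI)
    fix u v assume uv: "u \<in> euclid I" "v \<in> euclid I"
    have "ip I (f u) (f v) = (\<Sum>a\<in>I. (\<Sum>b\<in>I. u b * entry f a b) * (\<Sum>c\<in>I. v c * entry f a c))"
      by (simp add: ip_def GL_entry_expand[OF I f] uv)
    also have "\<dots> = (\<Sum>a\<in>I. \<Sum>b\<in>I. \<Sum>c\<in>I. u b * v c * (entry f a b * entry f a c))"
      by (simp add: sum_product algebra_simps)
    also have "\<dots> = (\<Sum>b\<in>I. \<Sum>a\<in>I. \<Sum>c\<in>I. u b * v c * (entry f a b * entry f a c))"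
      by (rule sum.swap)
    also have "\<dots> = (\<Sum>b\<in>I. \<Sum>c\<in>I. u b * v c * (\<Sum>a\<in>I. entry f a b * entry f a c))"
      unfolding sum_distrib_left by (intro sum.cong refl sum.swap)
    also have "\<dots> = (\<Sum>b\<in>I. \<Sum>c\<in>I. if b = c then u b * v c else 0)"
      using R by (intro sum.cong refl) auto
    also have "\<dots> = ip I u v" by (simp add: ip_def I)
    finally show "ip I (f u) (f v) = ip I u v" .
  qed
qed

lemma entry_inv:
  assumes I: "finite I" and f: "f \<in> carrier (GL I)" and a: "a \<in> I" and c: "c \<in> I"
  shows "(\<Sum>b\<in>I. entry f a b * entry (inv\<^bsub>GL I\<^esub> f) b c) = (if a = c then 1 else 0)"
    and "(\<Sum>b\<in>I. entry (inv\<^bsub>GL I\<^esub> f) a b * entry f b c) = (if a = c then 1 else 0)"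
proof -
  interpret group "GL I" by (rule group_GL)
  show "(\<Sum>b\<in>I. entry f a b * entry (inv\<^bsub>GL I\<^esub> f) b c) = (if a = c then 1 else 0)"
    using f c by (simp add: entry_one flip: entry_mult[OF I])
  show "(\<Sum>b\<in>I. entry (inv\<^bsub>GL I\<^esub> f) a b * entry f b c) = (if a = c then 1 else 0)"
    using f c by (simp add: entry_one flip: entry_mult[OF I])
qed

text \<open>Let F and G be the matrices of \<open>f\<close> and its inverse. Then F^T F = 1 and F G
  = 1 give F^T = F^T F G = G, hence F F^T = F G = 1.\<close>

lemma preserves_ip_rows_orthonormal:
  assumes I: "finite I" and f: "f \<in> carrier (GL I)"
    and cols: "\<And>b c. b \<in> I \<Longrightarrow> c \<in> I \<Longrightarrow>
      (\<Sum>a\<in>I. entry f a b * entry f a c) = (if b = c then 1 else 0)"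
    and a: "a \<in> I" and c: "c \<in> I"
  shows "(\<Sum>b\<in>I. entry f a b * entry f c b) = (if a = c then 1 else 0)"
proof -
  let ?g = "inv\<^bsub>GL I\<^esub> f"
  have "entry f c b = entry ?g b c" if b: "b \<in> I" for b
  proof -
    have "entry f c b = (\<Sum>x\<in>I. if x = c then entry f x b else 0)"
      using c I by simp
    also have "\<dots> = (\<Sum>x\<in>I. entry f x b * (\<Sum>y\<in>I. entry f x y * entry ?g y c))"
      by (intro sum.cong refl) (simp add: entry_inv(1)[OF I f _ c])
    also have "\<dots> = (\<Sum>y\<in>I. \<Sum>x\<in>I. entry f x b * entry f x y * entry ?g y c)"
      unfolding sum_distrib_left mult.assoc by (rule sum.swap)
    also have "\<dots> = (\<Sum>y\<in>I. (if b = y then entry ?g y c else 0))"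
      unfolding sum_distrib_right[symmetric] by (intro sum.cong refl) (simp add: cols b)
    also have "\<dots> = entry ?g b c" using b I by simp
    finally show ?thesis .
  qed
  then show ?thesis using entry_inv(1)[OF I f a c] by simp
qed

text \<open>The restriction to \<open>euclid I\<close> makes the map extensional, as membership in
  \<open>GL I\<close> demands, and the value 0 outside \<open>I\<close> keeps the image in
  \<open>euclid I\<close>.\<close>

definition mat_map :: "'i set \<Rightarrow> ('i \<Rightarrow> 'i \<Rightarrow> real) \<Rightarrow> ('i \<Rightarrow> real) \<Rightarrow> ('i \<Rightarrow> real)"
  where "mat_map I m = (\<lambda>v\<in>euclid I. \<lambda>a. if a \<in> I then \<Sum>b\<in>I. m a b * v b else 0)"

lemma mat_map_in_euclid: "v \<in> euclid I \<Longrightarrow> mat_map I m v \<in> euclid I"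
  by (simp add: mat_map_def euclid_def)

lemma mat_map_transpose:
  assumes I: "finite I" and v: "v \<in> euclid I"
    and cols: "\<And>b c. b \<in> I \<Longrightarrow> c \<in> I \<Longrightarrow> (\<Sum>a\<in>I. m a b * m a c) = (if b = c then 1 else 0)"
  shows "mat_map I (\<lambda>a b. m b a) (mat_map I m v) = v"
proof
  fix a
  show "mat_map I (\<lambda>a b. m b a) (mat_map I m v) a = v a"
  proof (cases "a \<in> I")
    case True
    have "mat_map I (\<lambda>a b. m b a) (mat_map I m v) a = (\<Sum>b\<in>I. m b a * mat_map I m v b)"
      using True mat_map_in_euclid[OF v, of m]
      by (simp add: mat_map_def[of I "\<lambda>a b. m b a"])
    also have "\<dots> = (\<Sum>b\<in>I. m b a * (\<Sum>c\<in>I. m b c * v c))"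
      using v by (simp add: mat_map_def)
    also have "\<dots> = (\<Sum>c\<in>I. \<Sum>b\<in>I. m b a * m b c * v c)"
      unfolding sum_distrib_left mult.assoc by (rule sum.swap)
    also have "\<dots> = (\<Sum>c\<in>I. if a = c then v c else 0)"
      unfolding sum_distrib_right[symmetric] by (intro sum.cong refl) (simp add: cols True)
    also have "\<dots> = v a" using True I by simp
    finally show ?thesis .
  next
    case False
    then show ?thesis
      using v mat_map_in_euclid[OF mat_map_in_euclid[OF v]] by (simp add: euclid_def)
  qed
qed

lemma entry_mat_map:
  assumes "finite I" "a \<in> I" "b \<in> I"
  shows "entry (mat_map I m) a b = m a b"
proof -
  have "entry (mat_map I m) a b = (\<Sum>c\<in>I. m a c * unit_vec b c)"
    using assms by (simp add: entry_def mat_map_def)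
  then show ?thesis
    using assms by (simp add: unit_vec_def if_distrib[of "\<lambda>x. _ * x"] cong: if_cong)
qed

text \<open>The transpose is the inverse: orthonormal columns make it a left inverse, orthonormal
  rows a right inverse. This produces both the limits of isometries and the signed shifts used
  later.\<close>

lemma mat_map_orthonormal_in_GL:
  assumes I: "finite I"
    and cols: "\<And>b c. b \<in> I \<Longrightarrow> c \<in> I \<Longrightarrow> (\<Sum>a\<in>I. m a b * m a c) = (if b = c then 1 else 0)"
    and rows: "\<And>a c. a \<in> I \<Longrightarrow> c \<in> I \<Longrightarrow> (\<Sum>b\<in>I. m a b * m c b) = (if a = c then 1 else 0)"
  shows "mat_map I m \<in> carrier (GL I)"
    and "\<forall>u\<in>euclid I. \<forall>v\<in>euclid I. ip I (mat_map I m u) (mat_map I m v) = ip I u v"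
proof -
  have "bij_betw (mat_map I m) (euclid I) (euclid I)"
  proof (rule bij_betw_byWitness[where f' = "mat_map I (\<lambda>a b. m b a)"])
    show "\<forall>v\<in>euclid I. mat_map I (\<lambda>a b. m b a) (mat_map I m v) = v"
      using mat_map_transpose[OF I _ cols] by blast
    show "\<forall>v\<in>euclid I. mat_map I m (mat_map I (\<lambda>a b. m b a) v) = v"
      using mat_map_transpose[OF I _ rows] by blast
  qed (auto simp: mat_map_in_euclid)
  moreover have "linear_on_euclid I (mat_map I m)"
    by (auto simp: linear_on_euclid_def mat_map_def sum.distrib sum_distrib_left euclid_def
        distrib_left mult.left_commute)
  ultimately show *: "mat_map I m \<in> carrier (GL I)"
    by (simp add: carrier_GL mat_map_def)
  show "\<forall>u\<in>euclid I. \<forall>v\<in>euclid I. ip I (mat_map I m u) (mat_map I m v) = ip I u v"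
    unfolding preserves_ip_iff_entries[OF I *] by (simp add: entry_mat_map I cols)
qed

section \<open>The group \<open>GL_tensor\<close> and the closedness of the cone of decomposable vectors\<close>

lemma carrier_GL_tensor: "f \<in> carrier (GL_tensor l d) \<longleftrightarrow>
    f \<in> carrier (GL (multi_indices l d)) \<and> f ` decomposables l d \<subseteq> decomposables l d"
  by (simp add: GL_tensor_def)

lemma mult_GL_tensor [simp]: "f \<otimes>\<^bsub>GL_tensor l d\<^esub> g = f \<otimes>\<^bsub>GL (multi_indices l d)\<^esub> g"
  and one_GL_tensor [simp]: "\<one>\<^bsub>GL_tensor l d\<^esub> = \<one>\<^bsub>GL (multi_indices l d)\<^esub>"
  by (simp_all add: GL_tensor_def)

text \<open>\<open>m_inv\<close> is a definite description over the carrier, and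
  \<open>GL_tensor l d\<close> has not been shown to be a group. Once the inverse formed in the
  ambient group lies in the smaller carrier, uniqueness identifies the two.\<close>

lemma inv_GL_tensor:
  assumes f: "f \<in> carrier (GL_tensor l d)"
    and g: "inv\<^bsub>GL (multi_indices l d)\<^esub> f \<in> carrier (GL_tensor l d)"
  shows "inv\<^bsub>GL_tensor l d\<^esub> f = inv\<^bsub>GL (multi_indices l d)\<^esub> f"
proof -
  interpret group "GL (multi_indices l d)" by (rule group_GL)
  show ?thesis
    unfolding m_inv_def[of "GL_tensor l d"]
    by (rule the_equality) (use f g in \<open>auto simp: carrier_GL_tensor intro: inv_equality[symmetric]\<close>)
qed

lemma decomposables_subset: "decomposables l d \<subseteq> tensor_space l d"
  by (auto simp: decomposables_def tensor_def euclid_def)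

lemma compactin_GL_tensor_topology:
  "compactin (GL_tensor_topology l d) K \<longleftrightarrow>
    compactin (GL_topology (multi_indices l d)) K \<and> K \<subseteq> carrier (GL_tensor l d)"
  by (simp add: GL_tensor_topology_def compactin_subtopology)

lemma multi_indices_less: "\<alpha> \<in> multi_indices l d \<Longrightarrow> i < l \<Longrightarrow> \<alpha> i < d i"
  by (auto simp: multi_indices_def)

lemma multi_indices_upd:
  "\<alpha> \<in> multi_indices l d \<Longrightarrow> i < l \<Longrightarrow> j < d i \<Longrightarrow> \<alpha>(i := j) \<in> multi_indices l d"
  by (auto simp: multi_indices_def PiE_def Pi_def extensional_def)

section \<open>Decomposable vectors form a closed set\<close>

text \<open>
  For fixed \<open>\<alpha>\<close> with \<open>T \<alpha> \<noteq> 0\<close> these equations characterise the decomposable vectors and express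
  closed conditions.
\<close>

lemma decomposable_cross_ratio:
  assumes T: "T \<in> decomposables l d" and \<alpha>: "\<alpha> \<in> multi_indices l d" and \<beta>: "\<beta> \<in> multi_indices l d"
  shows "(\<Prod>i<l. T (\<alpha>(i := \<beta> i))) = T \<beta> * T \<alpha> ^ (l - 1)"
proof -
  obtain x where T: "T = tensor l d x" using T by (auto simp: decomposables_def)
  have "(\<Prod>i<l. T (\<alpha>(i := \<beta> i))) = (\<Prod>i<l. \<Prod>j<l. x j ((\<alpha>(i := \<beta> i)) j))"
    using \<alpha> \<beta> by (intro prod.cong refl)
      (simp add: T tensor_def multi_indices_upd multi_indices_less)
  also have "\<dots> = (\<Prod>j<l. \<Prod>i<l. x j ((\<alpha>(i := \<beta> i)) j))" by (rule prod.swap)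
  \<comment> \<open>In coordinate \<open>j\<close> the modified index equals
    \<open>\<beta> j\<close> for \<open>i = j\<close> and \<open>\<alpha> j\<close> for the other
    \<open>l - 1\<close> values of \<open>i\<close>.\<close>
  also have "\<dots> = (\<Prod>j<l. x j (\<beta> j) * x j (\<alpha> j) ^ (l - 1))"
  proof (rule prod.cong[OF refl])
    fix j assume j: "j \<in> {..<l}"
    have "(\<Prod>i<l. x j ((\<alpha>(i := \<beta> i)) j)) = x j (\<beta> j) * (\<Prod>i\<in>{..<l} - {j}. x j ((\<alpha>(i := \<beta> i)) j))"
      using j by (subst prod.remove[of _ j]) auto
    also have "(\<Prod>i\<in>{..<l} - {j}. x j ((\<alpha>(i := \<beta> i)) j)) = (\<Prod>i\<in>{..<l} - {j}. x j (\<alpha> j))"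
      by (intro prod.cong) auto
    finally show "(\<Prod>i<l. x j ((\<alpha>(i := \<beta> i)) j)) = x j (\<beta> j) * x j (\<alpha> j) ^ (l - 1)"
      using j by simp
  qed
  also have "\<dots> = T \<beta> * T \<alpha> ^ (l - 1)"
    using \<alpha> \<beta> by (simp add: T tensor_def prod.distrib prod_power_distrib)
  finally show ?thesis .
qed

text \<open>At an index \<alpha> where the limit \<open>T\<close> does not vanish, the equations of
  \<open>decomposable_cross_ratio\<close> pass to the limit and rebuild \<open>T\<close> from its
  values on the lines through \<alpha>. If there is no such \<alpha>, then \<open>T\<close> is the
  zero tensor.\<close>

lemma decomposables_closed:
  assumes l: "0 < l" and S: "\<And>n. S n \<in> decomposables l d" and T: "T \<in> tensor_space l d"
    and lim: "\<And>\<alpha>. \<alpha> \<in> multi_indices l d \<Longrightarrow> (\<lambda>n. S n \<alpha>) \<longlonglongrightarrow> T \<alpha>"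
  shows "T \<in> decomposables l d"
proof (cases "\<exists>\<alpha>\<in>multi_indices l d. T \<alpha> \<noteq> 0")
  case True
  then obtain \<alpha> where \<alpha>: "\<alpha> \<in> multi_indices l d" and nz: "T \<alpha> \<noteq> 0" by blast
  have cross: "(\<Prod>i<l. T (\<alpha>(i := \<beta> i))) = T \<beta> * T \<alpha> ^ (l - 1)" if \<beta>: "\<beta> \<in> multi_indices l d" for \<beta>
  proof (rule LIMSEQ_unique)
    show "(\<lambda>n. \<Prod>i<l. S n (\<alpha>(i := \<beta> i))) \<longlonglongrightarrow> (\<Prod>i<l. T (\<alpha>(i := \<beta> i)))"
    proof (intro tendsto_prod lim)
      show "\<alpha>(i := \<beta> i) \<in> multi_indices l d" if "i \<in> {..<l}" for i
        using that \<alpha> \<beta> by (simp add: multi_indices_upd multi_indices_less)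
    qed
    show "(\<lambda>n. \<Prod>i<l. S n (\<alpha>(i := \<beta> i))) \<longlonglongrightarrow> T \<beta> * T \<alpha> ^ (l - 1)"
      unfolding decomposable_cross_ratio[OF S \<alpha> \<beta>] by (intro tendsto_intros lim \<alpha> \<beta>)
  qed
  \<comment> \<open>Factor \<open>i\<close> is the line of \<open>T\<close> through \<alpha> in
    direction \<open>i\<close>. The product of these lines is
    \<open>T \<beta> * T \<alpha> ^ (l - 1)\<close>, so factor 0, which exists because
    \<open>0 < l\<close>, divides the power out.\<close>
  define x where "x i j = (if j < d i then T (\<alpha>(i := j)) * (if i = 0 then inverse (T \<alpha> ^ (l - 1)) else 1)
    else 0)" for i j
  have "T = tensor l d x"
  proof
    fix \<beta>
    show "T \<beta> = tensor l d x \<beta>"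
    proof (cases "\<beta> \<in> multi_indices l d")
      case True
      then have "(\<Prod>i<l. x i (\<beta> i)) =
          (\<Prod>i<l. T (\<alpha>(i := \<beta> i)) * (if i = 0 then inverse (T \<alpha> ^ (l - 1)) else 1))"
        by (intro prod.cong refl) (simp add: x_def multi_indices_less)
      also have "\<dots> = (\<Prod>i<l. T (\<alpha>(i := \<beta> i))) * inverse (T \<alpha> ^ (l - 1))"
        using l by (simp add: prod.distrib)
      also have "\<dots> = T \<beta>" using nz cross[OF True] by simp
      finally show ?thesis using True by (simp add: tensor_def)
    next
      case False
      then show ?thesis using T by (simp add: tensor_def euclid_def)
    qed
  qed
  moreover have "\<forall>i<l. x i \<in> euclid {..<d i}" by (simp add: x_def euclid_def)
  ultimately show ?thesis unfolding decomposables_def by blast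
next
  case False
  \<comment> \<open>Here \<open>0 < l\<close> matters: for \<open>l = 0\<close> the empty product
    would be 1.\<close>
  then have "T = tensor l d (\<lambda>i j. 0)"
    using T l by (fastforce simp: tensor_def euclid_def)
  then show ?thesis unfolding decomposables_def by (force simp: euclid_def)
qed

section \<open>\<open>O_tensor\<close> is a compact subgroup\<close>

lemma O_tensor_iff: "f \<in> O_tensor l d \<longleftrightarrow> f \<in> carrier (GL_tensor l d) \<and>
    (\<forall>u\<in>tensor_space l d. \<forall>v\<in>tensor_space l d. ip_H l d (f u) (f v) = ip_H l d u v)"
  by (simp add: O_tensor_def)

text \<open>Bolzano-Weierstrass, applied to one index after the other: passing to a further
  subsequence keeps the convergence obtained before.\<close>

lemma finite_family_convergent_subseq:
  fixes s :: "'a \<Rightarrow> nat \<Rightarrow> real"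
  assumes "finite J" "\<And>j. j \<in> J \<Longrightarrow> Bseq (s j)"
  shows "\<exists>r. strict_mono (r :: nat \<Rightarrow> nat) \<and> (\<forall>j\<in>J. convergent (\<lambda>n. s j (r n)))"
  using assms
proof (induction J rule: finite_induct)
  case empty
  then show ?case using strict_mono_id by auto
next
  case (insert j J)
  then obtain r where r: "strict_mono (r :: nat \<Rightarrow> nat)" "\<forall>i\<in>J. convergent (\<lambda>n. s i (r n))"
    by auto
  have "bounded (range (\<lambda>n. s j (r n)))"
    using insert.prems[of j] by (auto simp: Bseq_eq_bounded intro: bounded_subset)
  from bounded_imp_convergent_subsequence[OF this] obtain t L
    where t: "strict_mono (t :: nat \<Rightarrow> nat)" "((\<lambda>n. s j (r n)) \<circ> t) \<longlonglongrightarrow> L" by blast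
  have "convergent (\<lambda>n. s i (r (t n)))" if "i \<in> insert j J" for i
    using that t r(2) convergent_subseq_convergent[of "\<lambda>n. s i (r n)" t]
    by (auto simp: o_def convergent_def)
  moreover have "strict_mono (r \<circ> t)" by (rule strict_mono_o[OF r(1) t(1)])
  ultimately show ?case by (intro exI[of _ "r \<circ> t"]) (simp add: o_def)
qed

text \<open>Orthonormal columns bound the entries by 1, so a subsequence converges entrywise.
  Orthonormality of rows and columns survives in the limit, which is therefore still invertible;
  preservation of decomposable vectors survives because these form a closed set.\<close>

lemma O_tensor_compact:
  assumes l: "0 < l"
  shows "compactin (GL_topology (multi_indices l d)) (O_tensor l d)"
proof -
  let ?I = "multi_indices l d"
  note I = finite_multi_indices[of l d]
  have "\<exists>f r. f \<in> O_tensor l d \<and> strict_mono (r :: nat \<Rightarrow> nat) \<and>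
      (\<forall>a\<in>?I. \<forall>b\<in>?I. (\<lambda>n. entry (\<sigma> (r n)) a b) \<longlonglongrightarrow> entry f a b)"
    if "range \<sigma> \<subseteq> O_tensor l d" for \<sigma>
  proof -
    have \<sigma>: "\<sigma> n \<in> O_tensor l d" for n using that by blast
    then have \<sigma>G: "\<sigma> n \<in> carrier (GL ?I)" for n by (simp add: O_tensor_iff carrier_GL_tensor)
    have cols: "(\<Sum>a\<in>?I. entry (\<sigma> n) a b * entry (\<sigma> n) a c) = (if b = c then 1 else 0)"
      if "b \<in> ?I" "c \<in> ?I" for n b c
      using \<sigma>[of n] preserves_ip_iff_entries[OF I \<sigma>G, of n] that by (auto simp: O_tensor_iff)
    have rows: "(\<Sum>b\<in>?I. entry (\<sigma> n) a b * entry (\<sigma> n) c b) = (if a = c then 1 else 0)"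
      if "a \<in> ?I" "c \<in> ?I" for n a c
      by (rule preserves_ip_rows_orthonormal[OF I \<sigma>G cols that])
    have "\<bar>entry (\<sigma> n) a b\<bar> \<le> 1" if "a \<in> ?I" "b \<in> ?I" for n a b
    proof -
      have "(entry (\<sigma> n) a b)\<^sup>2 \<le> (\<Sum>a\<in>?I. (entry (\<sigma> n) a b)\<^sup>2)"
        by (rule member_le_sum) (use that I in auto)
      also have "\<dots> = 1" using cols[OF that(2,2)] by (simp add: power2_eq_square)
      finally show ?thesis by (simp add: abs_square_le_1)
    qed
    then have "Bseq (\<lambda>n. entry (\<sigma> n) (fst p) (snd p))" if "p \<in> ?I \<times> ?I" for p
      using that by (intro BseqI'[of _ 1]) auto
    then have "\<exists>r. strict_mono (r :: nat \<Rightarrow> nat) \<and>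
        (\<forall>p\<in>?I \<times> ?I. convergent (\<lambda>n. entry (\<sigma> (r n)) (fst p) (snd p)))"
      using I by (intro finite_family_convergent_subseq) simp_all
    then obtain r where r: "strict_mono (r :: nat \<Rightarrow> nat)"
        and conv: "\<forall>p\<in>?I \<times> ?I. convergent (\<lambda>n. entry (\<sigma> (r n)) (fst p) (snd p))"
      by blast
    define m where "m a b = lim (\<lambda>n. entry (\<sigma> (r n)) a b)" for a b
    have lim: "(\<lambda>n. entry (\<sigma> (r n)) a b) \<longlonglongrightarrow> m a b" if "a \<in> ?I" "b \<in> ?I" for a b
      using conv that by (force simp: m_def convergent_LIMSEQ_iff)
    have m_cols: "(\<Sum>a\<in>?I. m a b * m a c) = (if b = c then 1 else 0)" if "b \<in> ?I" "c \<in> ?I" for b c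
    proof (rule LIMSEQ_unique)
      show "(\<lambda>n. \<Sum>a\<in>?I. entry (\<sigma> (r n)) a b * entry (\<sigma> (r n)) a c) \<longlonglongrightarrow> (\<Sum>a\<in>?I. m a b * m a c)"
        by (intro tendsto_intros lim that)
    qed (simp add: cols that)
    have m_rows: "(\<Sum>b\<in>?I. m a b * m c b) = (if a = c then 1 else 0)" if "a \<in> ?I" "c \<in> ?I" for a c
    proof (rule LIMSEQ_unique)
      show "(\<lambda>n. \<Sum>b\<in>?I. entry (\<sigma> (r n)) a b * entry (\<sigma> (r n)) c b) \<longlonglongrightarrow> (\<Sum>b\<in>?I. m a b * m c b)"
        by (intro tendsto_intros lim that)
    qed (simp add: rows that)
    note f = mat_map_orthonormal_in_GL[OF I m_cols m_rows]
    have "mat_map ?I m T \<in> decomposables l d" if T: "T \<in> decomposables l d" for T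
    proof (rule decomposables_closed[OF l])
      have Te: "T \<in> tensor_space l d" using T decomposables_subset by blast
      show "\<sigma> (r n) T \<in> decomposables l d" for n
        using \<sigma>[of "r n"] T by (auto simp: O_tensor_iff carrier_GL_tensor)
      show "mat_map ?I m T \<in> tensor_space l d" by (rule mat_map_in_euclid[OF Te])
      fix \<alpha> assume \<alpha>: "\<alpha> \<in> ?I"
      have "(\<lambda>n. \<Sum>b\<in>?I. T b * entry (\<sigma> (r n)) \<alpha> b) \<longlonglongrightarrow> (\<Sum>b\<in>?I. T b * m \<alpha> b)"
        by (intro tendsto_intros lim \<alpha>)
      then show "(\<lambda>n. \<sigma> (r n) T \<alpha>) \<longlonglongrightarrow> mat_map ?I m T \<alpha>"
        using \<alpha> Te by (simp add: GL_entry_expand[OF I \<sigma>G Te] mat_map_def mult.commute)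
    qed
    then have "mat_map ?I m \<in> O_tensor l d"
      using f by (auto simp: O_tensor_iff carrier_GL_tensor)
    then show ?thesis
      using r lim by (intro exI[of _ "mat_map ?I m"] exI[of _ r]) (simp add: entry_mat_map I)
  qed
  moreover have "O_tensor l d \<subseteq> carrier (GL ?I)" by (auto simp: O_tensor_iff carrier_GL_tensor)
  ultimately show ?thesis unfolding compactin_GL_iff[OF I] by blast
qed

section \<open>The subgroup property of \<open>O_tensor\<close>\<close>

lemma one_in_O_tensor: "\<one>\<^bsub>GL (multi_indices l d)\<^esub> \<in> O_tensor l d"
proof -
  interpret group "GL (multi_indices l d)" by (rule group_GL)
  show ?thesis
    using one_closed decomposables_subset[of l d]
    by (auto simp: O_tensor_iff carrier_GL_tensor one_GL)
qed

lemma O_tensor_mult_closed: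
  assumes "f \<in> O_tensor l d" "g \<in> O_tensor l d"
  shows "f \<otimes>\<^bsub>GL (multi_indices l d)\<^esub> g \<in> O_tensor l d"
proof -
  interpret group "GL (multi_indices l d)" by (rule group_GL)
  have fg: "f \<in> carrier (GL (multi_indices l d))" "g \<in> carrier (GL (multi_indices l d))"
    using assms by (auto simp: O_tensor_iff carrier_GL_tensor)
  then have "f \<otimes>\<^bsub>GL (multi_indices l d)\<^esub> g \<in> carrier (GL (multi_indices l d))" by simp
  moreover have "(f \<otimes>\<^bsub>GL (multi_indices l d)\<^esub> g) v = f (g v)" if "v \<in> tensor_space l d" for v
    using that by (simp add: mult_GL fg compose_eq)
  ultimately show ?thesis
    using assms subsetD[OF decomposables_subset[of l d]] carrier_GL_closed[OF fg(2)]
    by (simp add: O_tensor_iff carrier_GL_tensor image_subset_iff)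
qed

lemma O_tensor_subgroup:
  assumes "0 < l"
  shows "subgroup (O_tensor l d) (GL_tensor l d)"
proof
  show "O_tensor l d \<subseteq> carrier (GL_tensor l d)" by (auto simp: O_tensor_iff)
  show "f \<otimes>\<^bsub>GL_tensor l d\<^esub> g \<in> O_tensor l d" if "f \<in> O_tensor l d" "g \<in> O_tensor l d" for f g
    using O_tensor_mult_closed[OF that] by simp
  show "\<one>\<^bsub>GL_tensor l d\<^esub> \<in> O_tensor l d" by (simp add: one_in_O_tensor)
  show "inv\<^bsub>GL_tensor l d\<^esub> f \<in> O_tensor l d" if f: "f \<in> O_tensor l d" for f
  proof -
    have "inv\<^bsub>GL (multi_indices l d)\<^esub> f \<in> O_tensor l d"
      by (rule compact_submonoid_inv_closed[OF finite_multi_indices O_tensor_compact[OF assms]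
            one_in_O_tensor O_tensor_mult_closed f])
    then show ?thesis using f by (simp add: inv_GL_tensor O_tensor_iff)
  qed
qed

section \<open>Averaging over signed shifts\<close>

text \<open>The diagonal of a tensor product of diagonal sign matrices:
  \<open>(i, j) \<in> E\<close> means that the \<open>j\<close>-th basis vector of the
  \<open>i\<close>-th factor is negated.\<close>

definition flip_sign :: "nat \<Rightarrow> (nat \<times> nat) set \<Rightarrow> (nat \<Rightarrow> nat) \<Rightarrow> real"
  where "flip_sign l E \<alpha> = (\<Prod>i<l. if (i, \<alpha> i) \<in> E then -1 else 1)"

text \<open>A cyclic shift by \<open>s i\<close> in each factor \<open>i\<close>, restricted to
  \<open>{..<l}\<close> so that multi-indices go to multi-indices.\<close>

definition shift :: "nat \<Rightarrow> (nat \<Rightarrow> nat) \<Rightarrow> (nat \<Rightarrow> nat) \<Rightarrow> (nat \<Rightarrow> nat) \<Rightarrow> nat \<Rightarrow> nat"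
  where "shift l d s \<alpha> = (\<lambda>i\<in>{..<l}. (\<alpha> i + s i) mod d i)"

definition signed_shift :: "nat \<Rightarrow> (nat \<Rightarrow> nat) \<Rightarrow> (nat \<times> nat) set \<Rightarrow> (nat \<Rightarrow> nat) \<Rightarrow>
    ((nat \<Rightarrow> nat) \<Rightarrow> real) \<Rightarrow> ((nat \<Rightarrow> nat) \<Rightarrow> real)"
  where "signed_shift l d E s = mat_map (multi_indices l d)
    (\<lambda>\<alpha> \<beta>. if \<beta> = shift l d s \<alpha> then flip_sign l E \<alpha> else 0)"

lemma flip_sign_square: "flip_sign l E \<alpha> * flip_sign l E \<alpha> = 1"
  by (auto simp: flip_sign_def simp flip: prod.distrib intro!: prod.neutral)

lemma shift_in_multi_indices:
  "\<alpha> \<in> multi_indices l d \<Longrightarrow> shift l d s \<alpha> \<in> multi_indices l d"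
  by (fastforce simp: shift_def multi_indices_def PiE_def Pi_def intro: mod_less_divisor)

lemma shift_bij: "bij_betw (shift l d s) (multi_indices l d) (multi_indices l d)"
proof -
  have "inj_on (shift l d s) (multi_indices l d)"
  proof
    fix \<alpha> \<beta> assume ab: "\<alpha> \<in> multi_indices l d" "\<beta> \<in> multi_indices l d"
      and eq: "shift l d s \<alpha> = shift l d s \<beta>"
    show "\<alpha> = \<beta>"
    proof (rule PiE_ext)
      show "\<alpha> \<in> (\<Pi>\<^sub>E i\<in>{..<l}. {..<d i})" "\<beta> \<in> (\<Pi>\<^sub>E i\<in>{..<l}. {..<d i})"
        using ab by (auto simp: multi_indices_def)
      fix i assume i: "i \<in> {..<l}"
      have "[\<alpha> i + s i = \<beta> i + s i] (mod d i)"
        using fun_cong[OF eq, of i] i by (simp add: shift_def cong_def)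
      then have "[\<alpha> i = \<beta> i] (mod d i)" by (simp only: cong_add_rcancel_nat)
      then show "\<alpha> i = \<beta> i" using i ab by (simp add: cong_def multi_indices_less)
    qed
  qed
  moreover have "shift l d s ` multi_indices l d \<subseteq> multi_indices l d"
    by (auto simp: shift_in_multi_indices)
  ultimately show ?thesis
    using finite_multi_indices endo_inj_surj by (metis bij_betw_def)
qed

text \<open>This lets a sum over the shift \<open>s\<close> at a fixed multi-index \<alpha> be
  reindexed by the bijection \<open>shift l d \<alpha>\<close>.\<close>

lemma shift_commute: "shift l d s \<alpha> = shift l d \<alpha> s"
  by (simp add: shift_def add.commute)

text \<open>A signed permutation matrix: each row and each column has exactly one nonzero entry,
  equal to 1 or -1, because \<open>shift l d s\<close> is a bijection.\<close>

lemma signed_shift_in_GL: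
  fixes l d E s
  defines "m \<equiv> \<lambda>\<alpha> \<beta>. if \<beta> = shift l d s \<alpha> then flip_sign l E \<alpha> else 0"
  shows "signed_shift l d E s \<in> carrier (GL (multi_indices l d))"
    and "\<forall>u\<in>tensor_space l d. \<forall>v\<in>tensor_space l d.
      ip_H l d (signed_shift l d E s u) (signed_shift l d E s v) = ip_H l d u v"
proof -
  let ?I = "multi_indices l d"
  note I = finite_multi_indices[of l d] and bij = shift_bij[of l d s]
  have rows: "(\<Sum>\<beta>\<in>?I. m \<alpha> \<beta> * m \<gamma> \<beta>) = (if \<alpha> = \<gamma> then 1 else 0)"
    if "\<alpha> \<in> ?I" "\<gamma> \<in> ?I" for \<alpha> \<gamma>
  proof -
    have "(\<Sum>\<beta>\<in>?I. m \<alpha> \<beta> * m \<gamma> \<beta>) =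
        (\<Sum>\<beta>\<in>?I. if \<beta> = shift l d s \<alpha> then flip_sign l E \<alpha> * m \<gamma> \<beta> else 0)"
      by (intro sum.cong) (auto simp: m_def)
    also have "\<dots> = flip_sign l E \<alpha> * m \<gamma> (shift l d s \<alpha>)"
      using that I by (simp add: shift_in_multi_indices)
    also have "\<dots> = (if \<alpha> = \<gamma> then 1 else 0)"
      using that bij by (auto simp: m_def flip_sign_square bij_betw_def inj_on_def)
    finally show ?thesis .
  qed
  have cols: "(\<Sum>\<alpha>\<in>?I. m \<alpha> \<beta> * m \<alpha> \<gamma>) = (if \<beta> = \<gamma> then 1 else 0)"
    if bc: "\<beta> \<in> ?I" "\<gamma> \<in> ?I" for \<beta> \<gamma>
  proof -
    have "(\<Sum>\<alpha>\<in>?I. m \<alpha> \<beta> * m \<alpha> \<gamma>) =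
        (\<Sum>\<alpha>\<in>?I. if \<beta> = shift l d s \<alpha> \<and> \<gamma> = shift l d s \<alpha> then 1 else 0)"
      by (intro sum.cong) (auto simp: m_def flip_sign_square)
    also have "\<dots> = (\<Sum>\<alpha>\<in>?I. if \<beta> = \<alpha> \<and> \<gamma> = \<alpha> then 1 else 0)"
      by (rule sum.reindex_bij_betw[OF bij])
    also have "\<dots> = (\<Sum>\<alpha>\<in>?I. if \<alpha> = \<beta> then (if \<beta> = \<gamma> then 1 else 0) else 0)"
      by (intro sum.cong) auto
    also have "\<dots> = (if \<beta> = \<gamma> then 1 else 0)" using bc I by simp
    finally show ?thesis .
  qed
  note mat = mat_map_orthonormal_in_GL[OF I cols rows]
  show "signed_shift l d E s \<in> carrier (GL ?I)"
    using mat(1) unfolding signed_shift_def m_def .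
  show "\<forall>u\<in>tensor_space l d. \<forall>v\<in>tensor_space l d.
      ip_H l d (signed_shift l d E s u) (signed_shift l d E s v) = ip_H l d u v"
    using mat(2) unfolding signed_shift_def m_def .
qed

lemma signed_shift_apply:
  assumes "v \<in> tensor_space l d" "\<alpha> \<in> multi_indices l d"
  shows "signed_shift l d E s v \<alpha> = flip_sign l E \<alpha> * v (shift l d s \<alpha>)"
proof -
  have "signed_shift l d E s v \<alpha> =
      (\<Sum>\<beta>\<in>multi_indices l d. if \<beta> = shift l d s \<alpha> then flip_sign l E \<alpha> * v \<beta> else 0)"
    using assms by (auto simp: signed_shift_def mat_map_def intro!: sum.cong)
  then show ?thesis
    using assms finite_multi_indices by (simp add: shift_in_multi_indices)
qed

lemma signed_shift_in_O_tensor: "signed_shift l d E s \<in> O_tensor l d"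
proof -
  have "signed_shift l d E s T \<in> decomposables l d" if T: "T \<in> decomposables l d" for T
  proof -
    obtain x where x: "T = tensor l d x" using T by (auto simp: decomposables_def)
    \<comment> \<open>Signs and shifts act on each factor separately; \<open>y i\<close> is the
      image of \<open>x i\<close>, set to 0 beyond \<open>d i\<close> so that it lies in
      \<open>euclid {..<d i}\<close>.\<close>
    define y where "y i j = (if j < d i
      then (if (i, j) \<in> E then -1 else 1) * x i ((j + s i) mod d i) else 0)" for i j
    have Te: "T \<in> tensor_space l d" using T decomposables_subset by blast
    have "signed_shift l d E s T = tensor l d y"
    proof
      fix \<alpha>
      show "signed_shift l d E s T \<alpha> = tensor l d y \<alpha>"
      proof (cases "\<alpha> \<in> multi_indices l d")
        case True
        have "signed_shift l d E s T \<alpha> =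
            (\<Prod>i<l. (if (i, \<alpha> i) \<in> E then -1 else 1) * x i ((\<alpha> i + s i) mod d i))"
          unfolding signed_shift_apply[OF Te True] prod.distrib
          using True by (simp add: flip_sign_def x tensor_def shift_in_multi_indices)
            (simp add: shift_def)
        also have "\<dots> = tensor l d y \<alpha>"
          using True by (auto simp: tensor_def y_def multi_indices_less intro!: prod.cong)
        finally show ?thesis .
      next
        case False
        then show ?thesis using Te by (simp add: signed_shift_def mat_map_def tensor_def)
      qed
    qed
    moreover have "\<forall>i<l. y i \<in> euclid {..<d i}" by (simp add: y_def euclid_def)
    ultimately show ?thesis unfolding decomposables_def by blast
  qed
  then show ?thesis
    using signed_shift_in_GL by (auto simp: O_tensor_iff carrier_GL_tensor)
qed

text \<open>Orthogonality of sign characters. If \<alpha> and \<beta> differ at \<open>i\<close>,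
  toggling the membership of \<open>(i, \<alpha> i)\<close> in \<open>E\<close> negates the sign of
  \<alpha> and keeps that of \<beta>, so the sum equals its own negative.\<close>

lemma sum_flip_sign:
  assumes \<alpha>: "\<alpha> \<in> multi_indices l d" and \<beta>: "\<beta> \<in> multi_indices l d"
    and J: "J = Sigma {..<l} (\<lambda>i. {..<d i})"
  shows "(\<Sum>E\<in>Pow J. flip_sign l E \<alpha> * flip_sign l E \<beta>) = (if \<alpha> = \<beta> then 2 ^ card J else 0)"
proof (cases "\<alpha> = \<beta>")
  case True
  have "finite J" by (simp add: J)
  then show ?thesis using True by (simp add: flip_sign_square card_Pow)
next
  case False
  then obtain i where i: "i < l" "\<alpha> i \<noteq> \<beta> i"
    using \<alpha> \<beta> unfolding multi_indices_def by (metis PiE_ext lessThan_iff)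
  define p where "p = (i, \<alpha> i)"
  define t where "t E = (if p \<in> E then E - {p} else insert p E)" for E
  have "p \<in> J" using i \<alpha> by (simp add: p_def J multi_indices_less)
  then have "bij_betw t (Pow J) (Pow J)"
    by (intro bij_betw_byWitness[where f' = t]) (auto simp: t_def)
  moreover have "flip_sign l (t E) \<alpha> = - flip_sign l E \<alpha>" for E
  proof -
    have "(\<Prod>k\<in>{..<l} - {i}. if (k, \<alpha> k) \<in> t E then -1 else 1 :: real) =
        (\<Prod>k\<in>{..<l} - {i}. if (k, \<alpha> k) \<in> E then -1 else 1)"
      by (intro prod.cong) (auto simp: t_def p_def)
    moreover have "(i, \<alpha> i) \<in> t E \<longleftrightarrow> (i, \<alpha> i) \<notin> E" by (auto simp: t_def p_def)
    ultimately show ?thesis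
      using i unfolding flip_sign_def by (simp add: prod.remove[of "{..<l}" i])
  qed
  moreover have "flip_sign l (t E) \<beta> = flip_sign l E \<beta>" for E
    unfolding flip_sign_def using i by (intro prod.cong) (auto simp: t_def p_def)
  ultimately have "(\<Sum>E\<in>Pow J. flip_sign l E \<alpha> * flip_sign l E \<beta>) =
      (\<Sum>E\<in>Pow J. - flip_sign l E \<alpha> * flip_sign l E \<beta>)"
    using sum.reindex_bij_betw[of t "Pow J" "Pow J" "\<lambda>E. flip_sign l E \<alpha> * flip_sign l E \<beta>"]
    by simp
  then show ?thesis using False by (simp add: sum_negf)
qed

text \<open>Parseval's identity for random signs: the cross terms of the expanded square cancel by
  \<open>sum_flip_sign\<close>.\<close>

lemma sum_flip_sign_square:
  assumes J: "J = Sigma {..<l} (\<lambda>i. {..<d i})"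
  shows "(\<Sum>E\<in>Pow J. (\<Sum>\<alpha>\<in>multi_indices l d. flip_sign l E \<alpha> * u \<alpha>)\<^sup>2) =
    2 ^ card J * (\<Sum>\<alpha>\<in>multi_indices l d. (u \<alpha>)\<^sup>2)"
proof -
  let ?I = "multi_indices l d"
  have "(\<Sum>E\<in>Pow J. (\<Sum>\<alpha>\<in>?I. flip_sign l E \<alpha> * u \<alpha>)\<^sup>2) =
      (\<Sum>E\<in>Pow J. \<Sum>\<alpha>\<in>?I. \<Sum>\<beta>\<in>?I. flip_sign l E \<alpha> * flip_sign l E \<beta> * (u \<alpha> * u \<beta>))"
    by (simp add: power2_eq_square sum_product algebra_simps)
  also have "\<dots> = (\<Sum>\<alpha>\<in>?I. \<Sum>E\<in>Pow J. \<Sum>\<beta>\<in>?I. flip_sign l E \<alpha> * flip_sign l E \<beta> * (u \<alpha> * u \<beta>))"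
    by (rule sum.swap)
  also have "\<dots> = (\<Sum>\<alpha>\<in>?I. \<Sum>\<beta>\<in>?I. (\<Sum>E\<in>Pow J. flip_sign l E \<alpha> * flip_sign l E \<beta>) * (u \<alpha> * u \<beta>))"
    unfolding sum_distrib_right by (intro sum.cong refl sum.swap)
  also have "\<dots> = (\<Sum>\<alpha>\<in>?I. \<Sum>\<beta>\<in>?I. if \<alpha> = \<beta> then 2 ^ card J * (u \<alpha> * u \<beta>) else 0)"
    by (intro sum.cong refl) (simp add: sum_flip_sign[OF _ _ J])
  also have "\<dots> = 2 ^ card J * (\<Sum>\<alpha>\<in>?I. (u \<alpha>)\<^sup>2)"
    using finite_multi_indices by (simp add: sum_distrib_left power2_eq_square)
  finally show ?thesis .
qed

section \<open>The squared Frobenius norm and its average over signed shifts\<close>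

definition frob :: "'i set \<Rightarrow> (('i \<Rightarrow> real) \<Rightarrow> ('i \<Rightarrow> real)) \<Rightarrow> real"
  where "frob I f = (\<Sum>a\<in>I. \<Sum>b\<in>I. (entry f a b)\<^sup>2)"

text \<open>Summing over the signs \<open>E\<close> removes the cross terms in each entry of the
  product. Summing over the shifts \<open>s\<close> then pairs every column of \<open>f\<close> with
  every row of \<open>g\<close> exactly once, so the remaining sum of squares factors.\<close>

lemma sum_frob_signed_shift:
  fixes l d
  defines "I \<equiv> multi_indices l d" and "J \<equiv> Sigma {..<l} (\<lambda>i. {..<d i})"
  assumes f: "f \<in> carrier (GL I)" and g: "g \<in> carrier (GL I)"
  shows "(\<Sum>s\<in>I. \<Sum>E\<in>Pow J. frob I (f \<otimes>\<^bsub>GL I\<^esub> (signed_shift l d E s \<otimes>\<^bsub>GL I\<^esub> g))) =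
    2 ^ card J * frob I f * frob I g"
proof -
  interpret group "GL I" by (rule group_GL)
  have I: "finite I" unfolding I_def by (rule finite_multi_indices)
  have h: "signed_shift l d E s \<in> carrier (GL I)" for E s
    unfolding I_def by (rule signed_shift_in_GL)
  have entry: "entry (f \<otimes>\<^bsub>GL I\<^esub> (signed_shift l d E s \<otimes>\<^bsub>GL I\<^esub> g)) a c =
      (\<Sum>\<alpha>\<in>I. flip_sign l E \<alpha> * (entry f a \<alpha> * entry g (shift l d s \<alpha>) c))"
    if c: "c \<in> I" for E s a c
  proof -
    have "g (unit_vec c) \<in> euclid I" using g c by (simp add: carrier_GL_closed)
    then have "entry (signed_shift l d E s \<otimes>\<^bsub>GL I\<^esub> g) \<alpha> c =
        flip_sign l E \<alpha> * entry g (shift l d s \<alpha>) c" if "\<alpha> \<in> I" for \<alpha>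
      using that c by (simp add: entry_def mult_GL h g compose_eq) (simp add: signed_shift_apply I_def)
    then show ?thesis
      by (simp add: entry_mult I f g h c mult.left_commute)
  qed
  have "(\<Sum>s\<in>I. \<Sum>E\<in>Pow J. frob I (f \<otimes>\<^bsub>GL I\<^esub> (signed_shift l d E s \<otimes>\<^bsub>GL I\<^esub> g))) =
      (\<Sum>s\<in>I. \<Sum>E\<in>Pow J. \<Sum>a\<in>I. \<Sum>c\<in>I.
        (\<Sum>\<alpha>\<in>I. flip_sign l E \<alpha> * (entry f a \<alpha> * entry g (shift l d s \<alpha>) c))\<^sup>2)"
    unfolding frob_def by (intro sum.cong refl) (simp add: entry)
  also have "\<dots> = (\<Sum>s\<in>I. \<Sum>a\<in>I. \<Sum>c\<in>I. \<Sum>E\<in>Pow J.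
        (\<Sum>\<alpha>\<in>I. flip_sign l E \<alpha> * (entry f a \<alpha> * entry g (shift l d s \<alpha>) c))\<^sup>2)"
    by (intro sum.cong refl) (simp add: sum.swap[of _ _ "Pow J"])
  also have "\<dots> = (\<Sum>s\<in>I. \<Sum>a\<in>I. \<Sum>c\<in>I. 2 ^ card J *
        (\<Sum>\<alpha>\<in>I. (entry f a \<alpha> * entry g (shift l d s \<alpha>) c)\<^sup>2))"
    unfolding I_def by (simp only: sum_flip_sign_square[OF J_def[THEN meta_eq_to_obj_eq]])
  also have "\<dots> = 2 ^ card J * (\<Sum>s\<in>I. \<Sum>a\<in>I. \<Sum>c\<in>I. \<Sum>\<alpha>\<in>I.
        (entry f a \<alpha>)\<^sup>2 * (entry g (shift l d s \<alpha>) c)\<^sup>2)"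
    by (simp add: sum_distrib_left power_mult_distrib)
  also have "(\<Sum>s\<in>I. \<Sum>a\<in>I. \<Sum>c\<in>I. \<Sum>\<alpha>\<in>I. (entry f a \<alpha>)\<^sup>2 * (entry g (shift l d s \<alpha>) c)\<^sup>2) =
      (\<Sum>a\<in>I. \<Sum>s\<in>I. \<Sum>c\<in>I. \<Sum>\<alpha>\<in>I. (entry f a \<alpha>)\<^sup>2 * (entry g (shift l d s \<alpha>) c)\<^sup>2)"
    by (rule sum.swap)
  also have "\<dots> = (\<Sum>a\<in>I. \<Sum>s\<in>I. \<Sum>\<alpha>\<in>I. \<Sum>c\<in>I. (entry f a \<alpha>)\<^sup>2 * (entry g (shift l d s \<alpha>) c)\<^sup>2)"
    by (intro sum.cong refl sum.swap)
  also have "\<dots> = (\<Sum>a\<in>I. \<Sum>\<alpha>\<in>I. \<Sum>s\<in>I. \<Sum>c\<in>I. (entry f a \<alpha>)\<^sup>2 * (entry g (shift l d s \<alpha>) c)\<^sup>2)"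
    by (intro sum.cong refl sum.swap)
  also have "\<dots> = (\<Sum>a\<in>I. \<Sum>\<alpha>\<in>I. (entry f a \<alpha>)\<^sup>2 * frob I g)"
  proof (intro sum.cong refl)
    fix a \<alpha>
    \<comment> \<open>For fixed \<alpha>, \<open>shift l d s \<alpha>\<close> runs through every row
      index once as \<open>s\<close> runs through \<open>I\<close>.\<close>
    have "(\<Sum>s\<in>I. \<Sum>c\<in>I. (entry g (shift l d s \<alpha>) c)\<^sup>2) = frob I g"
      unfolding frob_def shift_commute[of l d _ \<alpha>] I_def by (rule sum.reindex_bij_betw[OF shift_bij])
    then show "(\<Sum>s\<in>I. \<Sum>c\<in>I. (entry f a \<alpha>)\<^sup>2 * (entry g (shift l d s \<alpha>) c)\<^sup>2) =
        (entry f a \<alpha>)\<^sup>2 * frob I g"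
      by (simp flip: sum_distrib_left)
  qed
  finally show ?thesis by (simp add: frob_def mult.assoc sum_distrib_right)
qed

section \<open>Maximality\<close>

lemma compact_overgroup_frob_le:
  fixes l d
  defines "I \<equiv> multi_indices l d"
  assumes K: "compactin (GL_topology I) K" and OK: "O_tensor l d \<subseteq> K"
    and mult: "\<And>f g. f \<in> K \<Longrightarrow> g \<in> K \<Longrightarrow> f \<otimes>\<^bsub>GL I\<^esub> g \<in> K"
    and f: "f \<in> K"
  shows "frob I f \<le> card I"
proof -
  have I: "finite I" unfolding I_def by (rule finite_multi_indices)
  have KG: "K \<subseteq> carrier (GL I)" using K by (simp add: compactin_GL_iff[OF I])
  obtain B where B: "\<And>f a b. f \<in> K \<Longrightarrow> a \<in> I \<Longrightarrow> b \<in> I \<Longrightarrow> \<bar>entry f a b\<bar> \<le> B"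
    by (rule compactin_GL_bounded_entries[OF I K]) blast
  have bdd: "bdd_above (frob I ` K)"
  proof (rule bdd_aboveI2)
    fix g assume "g \<in> K"
    then have "(entry g a b)\<^sup>2 \<le> B\<^sup>2" if "a \<in> I" "b \<in> I" for a b
      using B[OF _ that] by (metis abs_ge_zero power2_abs power_mono)
    then show "frob I g \<le> (\<Sum>a\<in>I. \<Sum>b\<in>I. B\<^sup>2)"
      unfolding frob_def by (intro sum_mono)
  qed
  define M where "M = (SUP g\<in>K. frob I g)"
  have le_M: "frob I g \<le> M" if "g \<in> K" for g
    unfolding M_def using bdd that by (rule cSUP_upper[rotated])
  define J where "J = Sigma {..<l} (\<lambda>i. {..<d i})"
  have J: "finite J" by (simp add: J_def)
  have frob_mult_le: "frob I f * frob I g \<le> card I * M" if g: "g \<in> K" for g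
  proof -
    have "2 ^ card J * frob I f * frob I g =
        (\<Sum>s\<in>I. \<Sum>E\<in>Pow J. frob I (f \<otimes>\<^bsub>GL I\<^esub> (signed_shift l d E s \<otimes>\<^bsub>GL I\<^esub> g)))"
      unfolding I_def J_def
      by (rule sum_frob_signed_shift[symmetric]) (use f g KG I_def in auto)
    also have "\<dots> \<le> (\<Sum>s\<in>I. \<Sum>E\<in>Pow J. M)"
      using signed_shift_in_O_tensor OK by (intro sum_mono le_M mult f g) blast
    \<comment> \<open>There are \<open>card I\<close> shifts and \<open>2 ^ card J\<close> sign
      patterns.\<close>
    also have "\<dots> = 2 ^ card J * (card I * M)" by (simp add: card_Pow J)
    finally show ?thesis by simp
  qed
  show ?thesis
  \<comment> \<open>For \<open>frob I f = 0\<close> the bound is immediate. Otherwise division by it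
    allows the supremum over \<open>g\<close>, and \<open>M\<close>, positive because it bounds
    \<open>frob I f\<close>, cancels.\<close>
  proof (cases "frob I f = 0")
    case False
    then have pos: "0 < frob I f" by (simp add: frob_def sum_nonneg less_le)
    have "frob I g \<le> card I * M / frob I f" if "g \<in> K" for g
      using frob_mult_le[OF that] pos by (simp add: pos_le_divide_eq mult.commute)
    then have "M \<le> card I * M / frob I f"
      unfolding M_def using f by (intro cSUP_least) auto
    moreover have "0 < M" using pos le_M[OF f] by simp
    ultimately show ?thesis using pos by (simp add: pos_le_divide_eq)
  qed simp
qed

text \<open>
  With \<open>g = f\<^sup>-\<^sup>1\<close>, the squared Frobenius distance of \<open>g\<close> and the transpose of \<open>f\<close> is
  \<open>frob f - 2 tr (f g) + frob g \<le> 0\<close>.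
\<close>

lemma frob_le_imp_preserves_ip:
  assumes I: "finite I" and f: "f \<in> carrier (GL I)"
    and le: "frob I f \<le> card I" "frob I (inv\<^bsub>GL I\<^esub> f) \<le> card I"
  shows "\<forall>u\<in>euclid I. \<forall>v\<in>euclid I. ip I (f u) (f v) = ip I u v"
proof -
  let ?g = "inv\<^bsub>GL I\<^esub> f"
  have "(\<Sum>a\<in>I. \<Sum>b\<in>I. (entry f a b - entry ?g b a)\<^sup>2) =
      frob I f + (\<Sum>a\<in>I. \<Sum>b\<in>I. (entry ?g b a)\<^sup>2) - 2 * (\<Sum>a\<in>I. \<Sum>b\<in>I. entry f a b * entry ?g b a)"
    by (simp add: frob_def power2_diff sum.distrib sum_subtractf sum_distrib_left mult.assoc)
  also have "(\<Sum>a\<in>I. \<Sum>b\<in>I. (entry ?g b a)\<^sup>2) = frob I ?g"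
    unfolding frob_def by (rule sum.swap)
  also have "(\<Sum>a\<in>I. \<Sum>b\<in>I. entry f a b * entry ?g b a) = card I"
    by (simp add: entry_inv(1)[OF I f])
  finally have "(\<Sum>a\<in>I. \<Sum>b\<in>I. (entry f a b - entry ?g b a)\<^sup>2) \<le> 0" using le by simp
  then have "(\<Sum>a\<in>I. \<Sum>b\<in>I. (entry f a b - entry ?g b a)\<^sup>2) = 0"
    by (intro antisym sum_nonneg) auto
  then have "entry f a b = entry ?g b a" if "a \<in> I" "b \<in> I" for a b
    using that I by (simp add: sum_nonneg_eq_0_iff sum_nonneg)
  then have "(\<Sum>a\<in>I. entry f a b * entry f a c) = (if b = c then 1 else 0)"
    if "b \<in> I" "c \<in> I" for b c
    \<comment> \<open>With the inverse equal to the transpose, the matrix form of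
      \<open>f^-1 f = 1\<close> is the orthonormality of the columns of \<open>f\<close>.\<close>
    using entry_inv(2)[OF I f that] that by simp
  then show ?thesis unfolding preserves_ip_iff_entries[OF I f] by blast
qed

theorem propositionA2:
  fixes l :: nat and d :: "nat \<Rightarrow> nat"
  assumes "2 \<le> l" and "\<forall>i<l. 2 \<le> d i"
  shows "maximal_compact_subgroup (GL_tensor l d) (GL_tensor_topology l d) (O_tensor l d)"
  unfolding maximal_compact_subgroup_def compact_subgroup_def compactin_GL_tensor_topology
proof (intro conjI allI impI)
  have l: "0 < l" using assms(1) by simp
  show "subgroup (O_tensor l d) (GL_tensor l d)" by (rule O_tensor_subgroup[OF l])
  show "compactin (GL_topology (multi_indices l d)) (O_tensor l d)" by (rule O_tensor_compact[OF l])
  show "O_tensor l d \<subseteq> carrier (GL_tensor l d)" by (auto simp: O_tensor_iff)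
next
  let ?I = "multi_indices l d"
  note I = finite_multi_indices[of l d]
  fix K
  assume "(subgroup K (GL_tensor l d) \<and> compactin (GL_topology ?I) K \<and> K \<subseteq> carrier (GL_tensor l d))
    \<and> O_tensor l d \<subseteq> K"
  then have K: "subgroup K (GL_tensor l d)" "compactin (GL_topology ?I) K"
    "K \<subseteq> carrier (GL_tensor l d)" "O_tensor l d \<subseteq> K" by auto
  have mult: "f \<otimes>\<^bsub>GL ?I\<^esub> g \<in> K" if "f \<in> K" "g \<in> K" for f g
    using subgroup.m_closed[OF K(1) that] by simp
  note frob_le = compact_overgroup_frob_le[OF K(2,4) mult]
  have "f \<in> O_tensor l d" if f: "f \<in> K" for f
  proof -
    have fG: "f \<in> carrier (GL_tensor l d)" using f K(3) by blast
    \<comment> \<open>The equality argument needs the Frobenius bound for the inverse as well, hence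
      the inverse in \<open>K\<close>.\<close>
    have "inv\<^bsub>GL ?I\<^esub> f \<in> K"
      using compact_submonoid_inv_closed[OF I K(2) _ mult f] one_in_O_tensor K(4) by blast
    then show ?thesis
      using fG frob_le_imp_preserves_ip[OF I, of f] frob_le f
      by (simp add: O_tensor_iff carrier_GL_tensor)
  qed
  then show "K = O_tensor l d" using K(4) by blast
qed

end
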